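(* The operators $\mathcal{G}_\ell=\sum_{E\in\mathfrak{G}_\ell}X(E)^2$, $\ell=1,\dots,7$, acting on $\mathbb{S}^7$, pairwise commute, and they commute with the sublaplacian $\Delta^{\mathrm{sub}}_{\mathrm{QH}}=\Delta_{\mathbb{S}^7}+X(A_6)^2+X(A_7)^2+X(A_6A_7)^2$.
   Context: Let $A_1,\dots,A_7\in\mathfrak{so}(8)$ be a fixed family of real skew-symmetric $8\times 8$ matrices with $A_iA_j+A_jA_i=-2\delta_{ij}I$ for $i,j=1,\dots,7$. For $A=(a_{lk})\in\mathfrak{so}(8)$ let $X(A)=\sum_{l,k=1}^8a_{lk}x_k\frac{\partial}{\partial x_l}$, a linear vector field on $\mathbb{R}^8$ tangent to the unit sphere $\mathbb{S}^7$; its restriction to $\mathbb{S}^7$ is denoted by the same symbol and regarded as a first order differential operator on $C^\infty(\mathbb{S}^7)$. $\Delta_{\mathbb{S}^7}=-\sum_{i=1}^7X(A_i)^2$ is the standard positive Laplacian on $\mathbb{S}^7$. The generating sets are $\mathfrak{G}_\ell=\{A_iA_j : 1\le i<j\le\ell+1\}$ for $1\le\ell\le4$; $\mathfrak{G}_5=\{A_iA_j : 1\le i<j\le5 \text{ or } (i,j)=(6,7)\}$; $\mathfrak{G}_6=\mathfrak{G}_5\cup\{A_6,A_7\}$; $\mathfrak{G}_7=\{A_iA_j : 1\le i<j\le7\}\cup\{A_k : 1\le k\le7\}$. *)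

theory Defs
  imports "HOL-Analysis.Analysis"
begin

section \<open>Smooth functions\<close>

text \<open>\<open>Ck_on k U F\<close>: all iterated directional derivatives of \<open>F\<close> up to order \<open>k\<close> exist
  as Frechet derivatives and are continuous on the (open) set \<open>U\<close>.\<close>

fun Ck_on :: "nat \<Rightarrow> 'a::real_normed_vector set \<Rightarrow> ('a \<Rightarrow> real) \<Rightarrow> bool" where
  "Ck_on 0 U F \<longleftrightarrow> continuous_on U F"
| "Ck_on (Suc k) U F \<longleftrightarrow> (\<forall>x\<in>U. F differentiable (at x)) \<and>
     (\<forall>v. Ck_on k U (\<lambda>x. frechet_derivative F (at x) v))"

definition smooth_on :: "'a::real_normed_vector set \<Rightarrow> ('a \<Rightarrow> real) \<Rightarrow> bool" where
  "smooth_on U F \<longleftrightarrow> (\<forall>k. Ck_on k U F)"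

text \<open>Functions on the sphere are represented by functions on the ambient space of which only
  the values on \<open>sphere 0 1\<close> matter. Such a function is smooth on the sphere iff, near each point
  of the sphere, it is the restriction of a smooth function of the ambient space.\<close>

definition smooth_on_sphere :: "(real^'n \<Rightarrow> real) \<Rightarrow> bool" where
  "smooth_on_sphere f \<longleftrightarrow> (\<forall>p\<in>sphere 0 1. \<exists>U F. open U \<and> p \<in> U \<and> smooth_on U F \<and>
     (\<forall>x\<in>U \<inter> sphere 0 1. f x = F x))"


section \<open>Linear vector fields\<close>

definition skew :: "real^'n^'n \<Rightarrow> bool" where
  "skew A \<longleftrightarrow> transpose A = - A"

definition lin_vf :: "real^'n^'n \<Rightarrow> (real^'n \<Rightarrow> real) \<Rightarrow> real^'n \<Rightarrow> real" where
  "lin_vf A F x = (\<Sum>l\<in>UNIV. \<Sum>k\<in>UNIV. A $ l $ k * x $ k * frechet_derivative F (at x) (axis l 1))"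

text \<open>The restriction of a linear vector field to the sphere differentiates the extension of
  \<open>f\<close> that is constant along rays. For a skew matrix the field is tangent to the sphere, so that
  any other differentiable local extension gives the same values on the sphere: see
  \<open>sphere_vf_eq\<close> below.\<close>

definition sphere_vf :: "real^'n^'n \<Rightarrow> (real^'n \<Rightarrow> real) \<Rightarrow> real^'n \<Rightarrow> real" where
  "sphere_vf A f = lin_vf A (\<lambda>y. f (y /\<^sub>R norm y))"

lemma lin_vf_eq_derivative:
  assumes "(F has_derivative F') (at x)"
  shows "lin_vf A F x = F' (A *v x)"
proof -
  interpret bounded_linear F' using assms by (rule has_derivative_bounded_linear)
  have fd: "frechet_derivative F (at x) = F'"
    using frechet_derivative_at[OF assms] by simp
  have "F' (A *v x) = F' (\<Sum>l\<in>UNIV. (A *v x) $ l *\<^sub>R axis l 1)"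
    using basis_expansion[of "A *v x"] by (simp add: scalar_mult_eq_scaleR)
  also have "\<dots> = (\<Sum>l\<in>UNIV. (A *v x) $ l * F' (axis l 1))"
    by (simp only: sum scaleR real_scaleR_def)
  also have "\<dots> = lin_vf A F x"
    unfolding lin_vf_def fd by (simp add: matrix_vector_mult_def sum_distrib_right)
  finally show ?thesis by simp
qed

lemma skew_tangent:
  assumes "skew A"
  shows "x \<bullet> (A *v x) = 0"
proof -
  have "transpose A *v x = - (A *v x)"
    using assms by (simp add: skew_def matrix_vector_mult_def vec_eq_iff sum_negf)
  then have "x \<bullet> (A *v x) = - ((A *v x) \<bullet> x)"
    by (metis dot_lmul_matrix inner_minus_left transpose_matrix_vector)
  also have "\<dots> = - (x \<bullet> (A *v x))"
    by (simp add: inner_commute)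
  finally show ?thesis by simp
qed

lemma sphere_vf_eq:
  fixes A :: "real^'n^'n"
  assumes "skew A" and x: "x \<in> sphere 0 1" and U: "open U" "x \<in> U"
    and F: "F differentiable (at x)" and eq: "\<And>y. y \<in> U \<inter> sphere 0 1 \<Longrightarrow> f y = F y"
  shows "sphere_vf A f x = lin_vf A F x"
proof -
  define r where "r = (\<lambda>y::real^'n. y /\<^sub>R norm y)"
  define r' where "r' = (\<lambda>h::real^'n. h - (x \<bullet> h) *\<^sub>R x)"
  have nx: "norm x = 1" "x \<noteq> 0" "r x = x" using x by (auto simp: r_def)
  have "(norm has_derivative (\<lambda>h. x \<bullet> h)) (at x)"
    using has_derivative_norm[OF nx(2)] nx by (simp add: sgn_div_norm inner_commute)
  then have "((\<lambda>y. inverse (norm y)) has_derivative (\<lambda>h. - (x \<bullet> h))) (at x)"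
    using Deriv.has_derivative_inverse[of norm x] nx by auto
  from has_derivative_scaleR[OF this has_derivative_ident]
  have "(r has_derivative (\<lambda>h. inverse (norm x) *\<^sub>R h + (- (x \<bullet> h)) *\<^sub>R x)) (at x)"
    by (simp only: r_def)
  moreover have "(\<lambda>h. inverse (norm x) *\<^sub>R h + (- (x \<bullet> h)) *\<^sub>R x) = r'"
    by (simp add: r'_def nx)
  ultimately have dr: "(r has_derivative r') (at x)"
    by (simp only:)
  obtain F' where F': "(F has_derivative F') (at x)"
    using F by (auto simp: differentiable_def)
  have dF: "((\<lambda>y. F (r y)) has_derivative (\<lambda>h. F' (r' h))) (at x)"
    using has_derivative_compose[OF dr, of F F'] F' nx by simp
  have "continuous_on (- {0}) r"
    unfolding r_def by (intro continuous_intros) auto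
  then have "open (r -` U \<inter> - {0})"
    using U(1) by (metis continuous_on_open_vimage open_Compl closed_singleton)
  then have "((\<lambda>y. f (r y)) has_derivative (\<lambda>h. F' (r' h))) (at x)"
    by (rule has_derivative_transform_within_open[OF dF])
      (use nx U(2) in \<open>auto intro!: eq[symmetric] simp: r_def\<close>)
  from lin_vf_eq_derivative[OF this] have "sphere_vf A f x = F' (r' (A *v x))"
    by (simp only: sphere_vf_def r_def)
  also have "r' (A *v x) = A *v x"
    by (simp add: r'_def skew_tangent[OF assms(1)])
  finally show ?thesis using lin_vf_eq_derivative[OF F'] by simp
qed


section \<open>The operators on the seven-sphere\<close>

text \<open>The family is indexed by \<open>1, \<dots>, 7\<close>; other values of \<open>A\<close> are irrelevant.\<close>

definition clifford_family :: "(nat \<Rightarrow> real^8^8) \<Rightarrow> bool" where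
  "clifford_family A \<longleftrightarrow> (\<forall>i\<in>{1..7}. skew (A i)) \<and>
     (\<forall>i\<in>{1..7}. \<forall>j\<in>{1..7}. A i ** A j + A j ** A i = (if i = j then - 2 else 0) *\<^sub>R mat 1)"

text \<open>Meaningful for \<open>1 \<le> l \<le> 7\<close> only.\<close>

definition gen_set :: "(nat \<Rightarrow> real^8^8) \<Rightarrow> nat \<Rightarrow> (real^8^8) set" where
  "gen_set A l =
    (let G5 = {A i ** A j | i j. (1 \<le> i \<and> i < j \<and> j \<le> 5) \<or> (i, j) = (6, 7)} in
     if l \<le> 4 then {A i ** A j | i j. 1 \<le> i \<and> i < j \<and> j \<le> l + 1}
     else if l = 5 then G5
     else if l = 6 then G5 \<union> {A 6, A 7}
     else {A i ** A j | i j. 1 \<le> i \<and> i < j \<and> j \<le> 7} \<union> {A k | k. 1 \<le> k \<and> k \<le> 7})"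

definition gen_op :: "(nat \<Rightarrow> real^8^8) \<Rightarrow> nat \<Rightarrow> (real^8 \<Rightarrow> real) \<Rightarrow> real^8 \<Rightarrow> real" where
  "gen_op A l f x = (\<Sum>E\<in>gen_set A l. sphere_vf E (sphere_vf E f) x)"

text \<open>At each point \<open>x\<close> of the sphere the vectors \<open>A i *v x\<close> form an orthonormal basis of the
  tangent space, and this is the positive Laplacian of the round metric.\<close>

definition sphere_laplacian :: "(nat \<Rightarrow> real^8^8) \<Rightarrow> (real^8 \<Rightarrow> real) \<Rightarrow> real^8 \<Rightarrow> real" where
  "sphere_laplacian A f x = - (\<Sum>i=1..7. sphere_vf (A i) (sphere_vf (A i) f) x)"

definition sublaplacian_QH :: "(nat \<Rightarrow> real^8^8) \<Rightarrow> (real^8 \<Rightarrow> real) \<Rightarrow> real^8 \<Rightarrow> real" where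
  "sublaplacian_QH A f x = sphere_laplacian A f x
     + sphere_vf (A 6) (sphere_vf (A 6) f) x
     + sphere_vf (A 7) (sphere_vf (A 7) f) x
     + sphere_vf (A 6 ** A 7) (sphere_vf (A 6 ** A 7) f) x"

definition commute_on_sphere ::
    "((real^'n \<Rightarrow> real) \<Rightarrow> real^'n \<Rightarrow> real) \<Rightarrow> ((real^'n \<Rightarrow> real) \<Rightarrow> real^'n \<Rightarrow> real) \<Rightarrow> bool" where
  "commute_on_sphere P Q \<longleftrightarrow>
     (\<forall>f. smooth_on_sphere f \<longrightarrow> (\<forall>x\<in>sphere 0 1. P (Q f) x = Q (P f) x))"

end

theory Submission
  imports Defs
begin

text \<open>On the sphere the fields satisfy \<open>[X(E), X(B)] = X(BE - EB)\<close>. Any two generators commute or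
  anticommute; if every \<open>E\<close> in a finite set \<open>T = -T\<close> that anticommutes with \<open>B\<close> has \<open>BE \<in> T\<close>,
  then \<open>\<Sum>\<^sub>E X(E)^2\<close> commutes with \<open>X(B)\<close>, because the contributions of \<open>E\<close> and \<open>BE\<close> to the
  commutator cancel. The generating sets increase with \<open>l\<close> and each is closed in this sense under
  its own members, so the \<open>gen_op\<close> commute.

  The Laplacian is not central at the level of matrices: the span of the \<open>A i\<close> is not closed under
  brackets with the generators. On the sphere, however, \<open>x\<close> and the \<open>A i x\<close> form an orthonormal
  basis, and so do their images under each \<open>A k\<close>. Comparing traces of the Hessian gives
  \<open>\<Sum>\<^bsub>E \<in> gen_set 7\<^esub> X(E)^2 = 4 \<Sum>\<^sub>i X(A i)^2\<close>. Hence the sublaplacian is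
  \<open>-1/4\<close> times the seventh operator plus the sum of squares over \<open>{A 6, A 7, A 6 A 7}\<close>, to which
  the same cancellation applies.\<close>

section \<open>Calculus of \<open>Ck_on\<close>: locality, sums, products, and equality of mixed
  derivatives\<close>

section \<open>Smooth functions\<close>

lemma frechet_derivative_cong_open:
  assumes "open U" "x \<in> U" "\<And>y. y \<in> U \<Longrightarrow> F y = G y" "F differentiable (at x)"
  shows "G differentiable (at x)" "frechet_derivative G (at x) = frechet_derivative F (at x)"
proof -
  have "(G has_derivative frechet_derivative F (at x)) (at x)"
    using has_derivative_transform_within_open[OF _ assms(1,2)] assms(3,4)
    by (metis frechet_derivative_works)
  then show "G differentiable (at x)" "frechet_derivative G (at x) = frechet_derivative F (at x)"
    by (auto simp: differentiable_def frechet_derivative_at[symmetric])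
qed

text \<open>The sum and product rules describe \<open>frechet_derivative\<close> only at points of
  \<open>U\<close>. Since derivatives are local and \<open>U\<close> is open, such a formula may
  replace the derivative inside the inductions on \<open>k\<close> below.\<close>

lemma Ck_on_cong:
  assumes "open U" "\<And>y. y \<in> U \<Longrightarrow> F y = G y" "Ck_on k U F"
  shows "Ck_on k U G"
  using assms(2,3)
proof (induction k arbitrary: F G)
  case 0
  then show ?case by (simp cong: continuous_on_cong)
next
  case (Suc k)
  have d: "F differentiable (at y)" if "y \<in> U" for y
    using Suc.prems(2) that by simp
  note eq = frechet_derivative_cong_open[OF assms(1) _ Suc.prems(1) d]
  have "Ck_on k U (\<lambda>x. frechet_derivative G (at x) v)" for v
  proof (rule Suc.IH)
    show "Ck_on k U (\<lambda>x. frechet_derivative F (at x) v)"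
      using Suc.prems(2) by simp
    show "frechet_derivative F (at y) v = frechet_derivative G (at y) v" if "y \<in> U" for y
      using eq(2)[OF that _ that] by simp
  qed
  then show ?case using eq(1) by simp
qed

lemma Ck_on_subset: "Ck_on k U F \<Longrightarrow> V \<subseteq> U \<Longrightarrow> Ck_on k V F"
  by (induction k arbitrary: F) (auto intro: continuous_on_subset)

lemma Ck_on_Suc_imp: "Ck_on (Suc k) U F \<Longrightarrow> Ck_on k U F"
proof (induction k arbitrary: F)
  case 0
  then show ?case
    by (auto intro!: continuous_at_imp_continuous_on differentiable_imp_continuous_within)
next
  case (Suc k)
  then show ?case by (metis Ck_on.simps(2))
qed

lemma Ck_on_const: "Ck_on k U (\<lambda>x. c)"
  by (induction k arbitrary: c) auto

lemma Ck_on_bounded_linear: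
  assumes "bounded_linear L"
  shows "Ck_on k U L"
proof (cases k)
  case 0
  then show ?thesis using assms by (simp add: linear_continuous_on)
next
  case (Suc k)
  have "frechet_derivative L (at x) = L" for x
    using bounded_linear_imp_has_derivative[OF assms, of "at x"] frechet_derivative_at by metis
  then show ?thesis
    using Suc Ck_on_const bounded_linear_imp_differentiable[OF assms] by auto
qed

lemma Ck_on_add:
  assumes "open U" "Ck_on k U F" "Ck_on k U G"
  shows "Ck_on k U (\<lambda>x. F x + G x)"
  using assms(2,3)
proof (induction k arbitrary: F G)
  case 0
  then show ?case by (auto intro: continuous_on_add)
next
  case (Suc k)
  have "Ck_on k U (\<lambda>x. frechet_derivative (\<lambda>x. F x + G x) (at x) v)" for v
  proof (rule Ck_on_cong[OF assms(1)])
    show "Ck_on k U (\<lambda>x. frechet_derivative F (at x) v + frechet_derivative G (at x) v)"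
      using Suc by simp
    show "frechet_derivative F (at y) v + frechet_derivative G (at y) v =
        frechet_derivative (\<lambda>x. F x + G x) (at y) v" if "y \<in> U" for y
    proof -
      have "(F has_derivative frechet_derivative F (at y)) (at y)"
        "(G has_derivative frechet_derivative G (at y)) (at y)"
        using that Suc.prems by (auto simp: frechet_derivative_works[symmetric])
      from frechet_derivative_at[OF has_derivative_add[OF this]] show ?thesis
        by metis
    qed
  qed
  then show ?case using Suc.prems by (auto intro: differentiable_add)
qed

lemma Ck_on_mult:
  assumes "open U" "Ck_on k U F" "Ck_on k U G"
  shows "Ck_on k U (\<lambda>x. F x * G x)"
  using assms(2,3)
proof (induction k arbitrary: F G)
  case 0
  then show ?case by (auto intro: continuous_on_mult)
next
  case (Suc k)
  have "Ck_on k U (\<lambda>x. frechet_derivative (\<lambda>x. F x * G x) (at x) v)" for v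
  proof (rule Ck_on_cong[OF assms(1)])
    \<comment> \<open>The product rule mixes undifferentiated factors with derivatives, so
      \<open>F\<close> and \<open>G\<close>, which are of order \<open>Suc k\<close>, are first
      lowered to order \<open>k\<close> to meet the induction hypothesis.\<close>
    show "Ck_on k U (\<lambda>x. F x * frechet_derivative G (at x) v + frechet_derivative F (at x) v * G x)"
      using Suc.prems Suc.prems[THEN Ck_on_Suc_imp]
      by (intro Ck_on_add[OF assms(1)] Suc.IH) auto
    show "F y * frechet_derivative G (at y) v + frechet_derivative F (at y) v * G y =
        frechet_derivative (\<lambda>x. F x * G x) (at y) v" if "y \<in> U" for y
    proof -
      have "(F has_derivative frechet_derivative F (at y)) (at y)"
        "(G has_derivative frechet_derivative G (at y)) (at y)"
        using that Suc.prems by (auto simp: frechet_derivative_works[symmetric])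
      from frechet_derivative_at[OF has_derivative_mult[OF this]] show ?thesis
        by metis
    qed
  qed
  then show ?case using Suc.prems by (auto intro: differentiable_mult)
qed

lemma smooth_on_differentiable: "smooth_on U F \<Longrightarrow> x \<in> U \<Longrightarrow> F differentiable (at x)"
  unfolding smooth_on_def by (metis Ck_on.simps(2))

lemma smooth_on_derivative: "smooth_on U F \<Longrightarrow> smooth_on U (\<lambda>x. frechet_derivative F (at x) v)"
  unfolding smooth_on_def by (metis Ck_on.simps(2))

lemma smooth_on_continuous: "smooth_on U F \<Longrightarrow> continuous_on U F"
  unfolding smooth_on_def by (metis Ck_on.simps(1))

lemma smooth_on_sum:
  assumes "open U" "\<And>i. i \<in> I \<Longrightarrow> smooth_on U (F i)"
  shows "smooth_on U (\<lambda>x. \<Sum>i\<in>I. F i x)"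
  using assms(2)
  by (induction I rule: infinite_finite_induct)
    (auto simp: smooth_on_def Ck_on_const intro: Ck_on_add[OF assms(1)])

lemma smooth_on_lin_vf:
  assumes "open U" "smooth_on U F"
  shows "smooth_on U (lin_vf A F)"
  unfolding lin_vf_def
proof (intro smooth_on_sum assms(1))
  fix l k
  show "smooth_on U (\<lambda>x. A $ l $ k * x $ k * frechet_derivative F (at x) (axis l 1))"
    unfolding smooth_on_def
    by (intro allI Ck_on_mult assms(1) Ck_on_const Ck_on_bounded_linear[OF bounded_linear_vec_nth]
      smooth_on_derivative[OF assms(2), unfolded smooth_on_def, rule_format])
qed

text \<open>Both mixed derivatives are limits of the second difference quotient: by two applications of
  the mean value theorem it equals a value of either mixed derivative at a nearby point.\<close>

lemma second_difference_mean_value: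
  fixes F :: "'a::real_normed_vector \<Rightarrow> real"
  assumes sm: "smooth_on (ball x e) F" and t: "0 < t" "t * (norm u + norm v) < e"
  obtains y where "dist x y \<le> t * (norm u + norm v)"
    "F (x + t *\<^sub>R u + t *\<^sub>R v) - F (x + t *\<^sub>R u) - F (x + t *\<^sub>R v) + F x =
      t * t * frechet_derivative (\<lambda>z. frechet_derivative F (at z) u) (at y) v"
proof -
  define D where "D = (\<lambda>z. frechet_derivative F (at z) u)"
  have bnd: "dist x (x + a *\<^sub>R u + b *\<^sub>R v) \<le> t * (norm u + norm v)"
    if "0 \<le> a" "a \<le> t" "0 \<le> b" "b \<le> t" for a b
  proof -
    have "norm (a *\<^sub>R u + b *\<^sub>R v) \<le> a * norm u + b * norm v"
      using norm_triangle_ineq[of "a *\<^sub>R u" "b *\<^sub>R v"] that by simp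
    also have "\<dots> \<le> t * norm u + t * norm v"
      using that by (intro add_mono mult_right_mono) auto
    finally show ?thesis
      by (metis add.assoc add.commute add_diff_cancel_left' dist_commute dist_norm ring_class.ring_distribs(1))
  qed
  have mem: "x + a *\<^sub>R u + b *\<^sub>R v \<in> ball x e" if "0 \<le> a" "a \<le> t" "0 \<le> b" "b \<le> t" for a b
    using bnd[OF that] t by simp
  have du: "((\<lambda>s. F (x + s *\<^sub>R u + b *\<^sub>R v)) has_real_derivative D (x + a *\<^sub>R u + b *\<^sub>R v)) (at a)"
    if "0 \<le> a" "a \<le> t" "0 \<le> b" "b \<le> t" for a b
  proof -
    have "(F has_derivative frechet_derivative F (at (x + a *\<^sub>R u + b *\<^sub>R v))) (at (x + a *\<^sub>R u + b *\<^sub>R v))"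
      using smooth_on_differentiable[OF sm mem[OF that]] frechet_derivative_works by blast
    note d = this
    have "((\<lambda>s. x + s *\<^sub>R u + b *\<^sub>R v) has_derivative (\<lambda>s. s *\<^sub>R u)) (at a)"
      by (auto intro!: derivative_eq_intros)
    from has_derivative_compose[OF this, of F "frechet_derivative F (at (x + a *\<^sub>R u + b *\<^sub>R v))"] d
    have "((\<lambda>s. F (x + s *\<^sub>R u + b *\<^sub>R v)) has_derivative (\<lambda>s. frechet_derivative F (at (x + a *\<^sub>R u + b *\<^sub>R v)) (s *\<^sub>R u))) (at a)"
      by simp
    then show ?thesis
      unfolding has_field_derivative_def
      by (simp add: linear_scale[OF has_derivative_linear[OF d]] mult_commute_abs D_def)
  qed
  have dv: "((\<lambda>s. D (x + a *\<^sub>R u + s *\<^sub>R v)) has_real_derivative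
      frechet_derivative D (at (x + a *\<^sub>R u + b *\<^sub>R v)) v) (at b)"
    if "0 \<le> a" "a \<le> t" "0 \<le> b" "b \<le> t" for a b
  proof -
    have "smooth_on (ball x e) D"
      unfolding D_def by (rule smooth_on_derivative[OF sm])
    then have "(D has_derivative frechet_derivative D (at (x + a *\<^sub>R u + b *\<^sub>R v))) (at (x + a *\<^sub>R u + b *\<^sub>R v))"
      using smooth_on_differentiable[OF _ mem[OF that]] frechet_derivative_works by blast
    note d = this
    have "((\<lambda>s. x + a *\<^sub>R u + s *\<^sub>R v) has_derivative (\<lambda>s. s *\<^sub>R v)) (at b)"
      by (auto intro!: derivative_eq_intros)
    from has_derivative_compose[OF this, of D "frechet_derivative D (at (x + a *\<^sub>R u + b *\<^sub>R v))"] d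
    have "((\<lambda>s. D (x + a *\<^sub>R u + s *\<^sub>R v)) has_derivative (\<lambda>s. frechet_derivative D (at (x + a *\<^sub>R u + b *\<^sub>R v)) (s *\<^sub>R v))) (at b)"
      by simp
    then show ?thesis
      unfolding has_field_derivative_def
      by (simp add: linear_scale[OF has_derivative_linear[OF d]] mult_commute_abs)
  qed
  \<comment> \<open>Difference in direction \<open>v\<close>, regarded as a function of the
    parameter along \<open>u\<close>. The term \<open>0 *\<^sub>R v\<close> gives both summands the
    shape of \<open>du\<close>, with \<open>b = t\<close> and \<open>b = 0\<close>.\<close>
  define p where "p = (\<lambda>s. F (x + s *\<^sub>R u + t *\<^sub>R v) - F (x + s *\<^sub>R u + 0 *\<^sub>R v))"
  have "\<exists>a>0. a < t \<and> p t - p 0 =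
      (t - 0) * (D (x + a *\<^sub>R u + t *\<^sub>R v) - D (x + a *\<^sub>R u + 0 *\<^sub>R v))"
    unfolding p_def by (intro MVT2 t DERIV_diff du) (use t in auto)
  then obtain a where a: "0 < a" "a < t"
    "p t - p 0 = t * (D (x + a *\<^sub>R u + t *\<^sub>R v) - D (x + a *\<^sub>R u + 0 *\<^sub>R v))" by auto
  have "\<exists>b>0. b < t \<and> D (x + a *\<^sub>R u + t *\<^sub>R v) - D (x + a *\<^sub>R u + 0 *\<^sub>R v) =
      (t - 0) * frechet_derivative D (at (x + a *\<^sub>R u + b *\<^sub>R v)) v"
    by (intro MVT2 t dv) (use t a in auto)
  then obtain b where b: "0 < b" "b < t" "D (x + a *\<^sub>R u + t *\<^sub>R v) - D (x + a *\<^sub>R u + 0 *\<^sub>R v) =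
      t * frechet_derivative D (at (x + a *\<^sub>R u + b *\<^sub>R v)) v" by auto
  show thesis
  proof (rule that)
    show "dist x (x + a *\<^sub>R u + b *\<^sub>R v) \<le> t * (norm u + norm v)"
      using a b by (intro bnd) auto
    show "F (x + t *\<^sub>R u + t *\<^sub>R v) - F (x + t *\<^sub>R u) - F (x + t *\<^sub>R v) + F x =
      t * t * frechet_derivative (\<lambda>z. frechet_derivative F (at z) u) (at (x + a *\<^sub>R u + b *\<^sub>R v)) v"
      using a(3) b(3) by (simp add: p_def D_def[symmetric])
  qed
qed

lemma symmetric_second_derivative:
  fixes F :: "'a::real_normed_vector \<Rightarrow> real"
  assumes "open U" "x \<in> U" "smooth_on U F"
  shows "frechet_derivative (\<lambda>z. frechet_derivative F (at z) u) (at x) v =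
    frechet_derivative (\<lambda>z. frechet_derivative F (at z) v) (at x) u"
proof -
  define H where "H = (\<lambda>u v y. frechet_derivative (\<lambda>z. frechet_derivative F (at z) u) (at y) v)"
  obtain e where e: "0 < e" "ball x e \<subseteq> U" using assms(1,2) open_contains_ball by blast
  have sm: "smooth_on (ball x e) F" using assms(3) Ck_on_subset[OF _ e(2)] by (auto simp: smooth_on_def)
  \<comment> \<open>The summand 1 keeps \<open>c\<close> positive when both directions vanish, so
    that the bound on \<open>t\<close> can be divided by \<open>c\<close>.\<close>
  define c where "c = norm u + norm v + 1"
  have c: "c > 0" by (simp add: c_def add_nonneg_pos)
  \<comment> \<open>The quotient is unchanged when \<open>u\<close> and \<open>v\<close> are
    exchanged. Hence one limit argument identifies its limit with both mixed derivatives.\<close>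
  define q where "q = (\<lambda>t. (F (x + t *\<^sub>R u + t *\<^sub>R v) - F (x + t *\<^sub>R u) - F (x + t *\<^sub>R v) + F x) / (t * t))"
  have lim: "(q \<longlongrightarrow> H u' v' x) (at_right 0)"
    if uv: "(u', v') = (u, v) \<or> (u', v') = (v, u)" for u' v'
  proof (rule tendstoI)
    fix r :: real assume "0 < r"
    have "continuous_on (ball x e) (H u' v')"
      unfolding H_def by (intro smooth_on_continuous smooth_on_derivative sm)
    then obtain d where d: "0 < d" "\<And>y. y \<in> ball x e \<Longrightarrow> dist y x < d \<Longrightarrow> dist (H u' v' y) (H u' v' x) < r"
      using \<open>0 < r\<close> e(1) unfolding continuous_on_iff by (metis centre_in_ball)
    have "dist (q t) (H u' v' x) < r" if t: "0 < t" "t < min e d / c" for t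
    proof -
      have "t * (norm u' + norm v') \<le> t * c" using uv t(1) by (auto simp: c_def)
      also have "\<dots> < min e d" using t(2) c by (simp add: field_simps)
      finally have l: "t * (norm u' + norm v') < min e d" .
      then obtain y where y: "dist x y \<le> t * (norm u' + norm v')"
        "F (x + t *\<^sub>R u' + t *\<^sub>R v') - F (x + t *\<^sub>R u') - F (x + t *\<^sub>R v') + F x = t * t * H u' v' y"
        using second_difference_mean_value[OF sm t(1), of u' v'] unfolding H_def by auto
      have "F (x + t *\<^sub>R u + t *\<^sub>R v) - F (x + t *\<^sub>R u) - F (x + t *\<^sub>R v) + F x = t * t * H u' v' y"
        using uv y(2) by (auto simp: algebra_simps)
      then have "q t = H u' v' y" using t(1) by (simp add: q_def)
      then show ?thesis using d(2)[of y] y(1) l by (simp add: dist_commute)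
    qed
    moreover have "0 < min e d / c" using e d c by simp
    ultimately show "\<forall>\<^sub>F t in at_right 0. dist (q t) (H u' v' x) < r"
      unfolding eventually_at_right_field by blast
  qed
  have "H u v x = H v u x"
    by (rule tendsto_unique[OF _ lim[of u v] lim[of v u]]) auto
  then show ?thesis by (simp add: H_def)
qed

section \<open>Derivations of functions on the sphere, their linearity, and their second-order
  jets\<close>

section \<open>Vector fields on the sphere\<close>

lemma smooth_on_subset: "smooth_on U F \<Longrightarrow> V \<subseteq> U \<Longrightarrow> smooth_on V F"
  by (auto simp: smooth_on_def intro: Ck_on_subset)

lemma smooth_on_add:
  "open U \<Longrightarrow> smooth_on U F \<Longrightarrow> smooth_on U G \<Longrightarrow> smooth_on U (\<lambda>x. F x + G x)"
  by (simp add: smooth_on_def Ck_on_add)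

lemma smooth_on_cmult: "open U \<Longrightarrow> smooth_on U F \<Longrightarrow> smooth_on U (\<lambda>x. c * F x)"
  by (simp add: smooth_on_def Ck_on_mult Ck_on_const)

lemma smooth_on_sphereD:
  assumes "smooth_on_sphere f" "p \<in> sphere 0 1"
  shows "\<exists>U F. open U \<and> p \<in> U \<and> smooth_on U F \<and> (\<forall>y\<in>U \<inter> sphere 0 1. f y = F y)"
  using assms unfolding smooth_on_sphere_def by blast

lemma sphere_vf_local:
  fixes A :: "real^'n^'n"
  assumes "skew A" "open U" "smooth_on U F" "\<And>y. y \<in> U \<inter> sphere 0 1 \<Longrightarrow> f y = F y"
    and "x \<in> U \<inter> sphere 0 1"
  shows "sphere_vf A f x = lin_vf A F x"
  using assms by (intro sphere_vf_eq) (auto intro: smooth_on_differentiable)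

lemma smooth_on_sphere_vf:
  fixes A :: "real^'n^'n"
  assumes "skew A" "smooth_on_sphere f"
  shows "smooth_on_sphere (sphere_vf A f)"
  unfolding smooth_on_sphere_def
proof
  fix p :: "real^'n" assume "p \<in> sphere 0 1"
  from smooth_on_sphereD[OF assms(2) this] obtain U F where
    "open U" "p \<in> U" "smooth_on U F" "\<And>y. y \<in> U \<inter> sphere 0 1 \<Longrightarrow> f y = F y"
    by blast
  then show "\<exists>U F. open U \<and> p \<in> U \<and> smooth_on U F \<and> (\<forall>x\<in>U \<inter> sphere 0 1. sphere_vf A f x = F x)"
    by (intro exI[of _ U] exI[of _ "lin_vf A F"]) (auto intro: smooth_on_lin_vf sphere_vf_local[OF assms(1)])
qed

lemma smooth_on_sphere_add:
  assumes "smooth_on_sphere f" "smooth_on_sphere g"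
  shows "smooth_on_sphere (\<lambda>x. f x + g x)"
  unfolding smooth_on_sphere_def
proof
  fix p :: "real^'a" assume p: "p \<in> sphere 0 1"
  obtain U F where U: "open U" "p \<in> U" "smooth_on U F" "\<And>y. y \<in> U \<inter> sphere 0 1 \<Longrightarrow> f y = F y"
    using smooth_on_sphereD[OF assms(1) p] by blast
  obtain V G where V: "open V" "p \<in> V" "smooth_on V G" "\<And>y. y \<in> V \<inter> sphere 0 1 \<Longrightarrow> g y = G y"
    using smooth_on_sphereD[OF assms(2) p] by blast
  show "\<exists>U F. open U \<and> p \<in> U \<and> smooth_on U F \<and> (\<forall>x\<in>U \<inter> sphere 0 1. f x + g x = F x)"
    using U V by (intro exI[of _ "U \<inter> V"] exI[of _ "\<lambda>x. F x + G x"])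
      (auto intro: smooth_on_add smooth_on_subset)
qed

lemma smooth_on_sphere_cmult:
  assumes "smooth_on_sphere f"
  shows "smooth_on_sphere (\<lambda>x. c * f x)"
  unfolding smooth_on_sphere_def
proof
  fix p :: "real^'a" assume p: "p \<in> sphere 0 1"
  obtain U F where U: "open U" "p \<in> U" "smooth_on U F" "\<And>y. y \<in> U \<inter> sphere 0 1 \<Longrightarrow> f y = F y"
    using smooth_on_sphereD[OF assms(1) p] by blast
  show "\<exists>U F. open U \<and> p \<in> U \<and> smooth_on U F \<and> (\<forall>x\<in>U \<inter> sphere 0 1. c * f x = F x)"
    using U by (intro exI[of _ U] exI[of _ "\<lambda>x. c * F x"]) (auto intro: smooth_on_cmult)
qed

lemma smooth_on_sphere_zero: "smooth_on_sphere (\<lambda>x. 0)"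
  unfolding smooth_on_sphere_def smooth_on_def
  by (intro ballI exI[of _ UNIV] exI[of _ "\<lambda>x. 0"]) (auto simp: Ck_on_const)

lemma smooth_on_sphere_sum:
  assumes "\<And>i. i \<in> I \<Longrightarrow> smooth_on_sphere (f i)"
  shows "smooth_on_sphere (\<lambda>x. \<Sum>i\<in>I. f i x)"
  using assms by (induction I rule: infinite_finite_induct)
    (auto simp: smooth_on_sphere_zero intro: smooth_on_sphere_add)

text \<open>Identities between derived functions, such as the commutator formulas, hold only at
  points of the sphere. This lemma allows them to be used underneath a further field.\<close>

lemma sphere_vf_cong:
  fixes A :: "real^'n^'n"
  assumes "skew A" "smooth_on_sphere f" "\<And>y. y \<in> sphere 0 1 \<Longrightarrow> f y = g y" "x \<in> sphere 0 1"
  shows "sphere_vf A f x = sphere_vf A g x"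
proof -
  obtain U F where "open U" "x \<in> U" "smooth_on U F" "\<And>y. y \<in> U \<inter> sphere 0 1 \<Longrightarrow> f y = F y"
    using smooth_on_sphereD[OF assms(2,4)] by blast
  then show ?thesis
    using sphere_vf_local[OF assms(1), of U F f x] sphere_vf_local[OF assms(1), of U F g x] assms(3,4)
    by auto
qed

lemma sphere_vf_add:
  fixes A :: "real^'n^'n"
  assumes A: "skew A" and "smooth_on_sphere f" "smooth_on_sphere g" and x: "x \<in> sphere 0 1"
  shows "sphere_vf A (\<lambda>y. f y + g y) x = sphere_vf A f x + sphere_vf A g x"
proof -
  obtain U F where U: "open U" "x \<in> U" "smooth_on U F" "\<And>y. y \<in> U \<inter> sphere 0 1 \<Longrightarrow> f y = F y"
    using smooth_on_sphereD[OF assms(2) x] by blast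
  obtain V G where V: "open V" "x \<in> V" "smooth_on V G" "\<And>y. y \<in> V \<inter> sphere 0 1 \<Longrightarrow> g y = G y"
    using smooth_on_sphereD[OF assms(3) x] by blast
  have "sphere_vf A (\<lambda>y. f y + g y) x = lin_vf A (\<lambda>y. F y + G y) x"
    using U V x by (intro sphere_vf_local[OF A, of "U \<inter> V"])
      (auto intro: smooth_on_add smooth_on_subset)
  also have "\<dots> = frechet_derivative F (at x) (A *v x) + frechet_derivative G (at x) (A *v x)"
    by (intro lin_vf_eq_derivative has_derivative_add)
      (use U V smooth_on_differentiable frechet_derivative_works in blast)+
  also have "\<dots> = lin_vf A F x + lin_vf A G x"
    using U V smooth_on_differentiable frechet_derivative_works lin_vf_eq_derivative by metis
  also have "\<dots> = sphere_vf A f x + sphere_vf A g x"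
    using sphere_vf_local[OF A U(1,3,4)] sphere_vf_local[OF A V(1,3,4)] U(2) V(2) x by simp
  finally show ?thesis .
qed

lemma sphere_vf_cmult:
  fixes A :: "real^'n^'n"
  assumes A: "skew A" and "smooth_on_sphere f" and x: "x \<in> sphere 0 1"
  shows "sphere_vf A (\<lambda>y. c * f y) x = c * sphere_vf A f x"
proof -
  obtain U F where U: "open U" "x \<in> U" "smooth_on U F" "\<And>y. y \<in> U \<inter> sphere 0 1 \<Longrightarrow> f y = F y"
    using smooth_on_sphereD[OF assms(2) x] by blast
  have "sphere_vf A (\<lambda>y. c * f y) x = lin_vf A (\<lambda>y. c * F y) x"
    using U x by (intro sphere_vf_local[OF A, of U]) (auto intro: smooth_on_cmult)
  also have "\<dots> = c * frechet_derivative F (at x) (A *v x)"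
    by (intro lin_vf_eq_derivative has_derivative_mult_right)
      (use U smooth_on_differentiable frechet_derivative_works in blast)
  also have "\<dots> = c * lin_vf A F x"
    using U smooth_on_differentiable frechet_derivative_works lin_vf_eq_derivative by metis
  also have "\<dots> = c * sphere_vf A f x"
    using sphere_vf_local[OF A U(1,3,4)] U(2) x by simp
  finally show ?thesis .
qed

lemma sphere_vf_sum:
  fixes A :: "real^'n^'n"
  assumes A: "skew A" and f: "\<And>i. i \<in> I \<Longrightarrow> smooth_on_sphere (f i)" and x: "x \<in> sphere 0 1"
  shows "sphere_vf A (\<lambda>y. \<Sum>i\<in>I. f i y) x = (\<Sum>i\<in>I. sphere_vf A (f i) x)"
proof -
  have 0: "sphere_vf A (\<lambda>y. 0) x = 0"
    using sphere_vf_cmult[OF A smooth_on_sphere_zero x, of 0] by simp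
  show ?thesis
    using f by (induction I rule: infinite_finite_induct)
      (auto simp: 0 sphere_vf_add[OF A _ _ x] smooth_on_sphere_sum)
qed

text \<open>The product rule for the derivative of \<open>F\<close> at \<open>y\<close> applied to
  \<open>G *v y\<close>: one term differentiates the derivative with its direction frozen at
  \<open>G *v x\<close>, the other differentiates the moving direction.\<close>

lemma lin_vf_lin_vf:
  fixes F :: "real^'n \<Rightarrow> real"
  assumes "open U" "x \<in> U" "smooth_on U F"
  shows "lin_vf E (lin_vf G F) x =
    frechet_derivative (\<lambda>z. frechet_derivative F (at z) (G *v x)) (at x) (E *v x) +
    frechet_derivative F (at x) (G *v (E *v x))"
proof -
  define L where "L = (\<lambda>z. frechet_derivative F (at z))"
  define H where "H = (\<lambda>v. frechet_derivative (\<lambda>z. L z v) (at x))"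
  have dF: "(F has_derivative L z) (at z)" if "z \<in> U" for z
    using smooth_on_differentiable[OF assms(3) that] by (simp add: L_def frechet_derivative_works)
  have dL: "((\<lambda>z. L z v) has_derivative H v) (at x)" for v
    using smooth_on_differentiable[OF smooth_on_derivative[OF assms(3)] assms(2)]
    by (simp add: L_def H_def frechet_derivative_works[symmetric])
  \<comment> \<open>Smoothness makes \<open>L z v\<close> differentiable in \<open>z\<close> for
    each fixed \<open>v\<close>. The moving direction \<open>G *v y\<close> is therefore expanded in
    coordinates before the product rule is applied.\<close>
  have bil: "L z w = (\<Sum>l\<in>UNIV. w $ l * L z (axis l 1))" if "z \<in> U" for z w
  proof -
    have "linear (L z)" using dF[OF that] by (rule has_derivative_linear)
    then have "L z (\<Sum>l\<in>UNIV. w $ l *\<^sub>R axis l 1) = (\<Sum>l\<in>UNIV. w $ l * L z (axis l 1))"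
      by (simp add: linear_sum linear_scale)
    then show ?thesis by (metis basis_expansion scalar_mult_eq_scaleR)
  qed
  have dG: "((\<lambda>y. (G *v y) $ l) has_derivative (\<lambda>h. (G *v h) $ l)) (at x)" for l
    by (intro bounded_linear_imp_has_derivative bounded_linear_compose[OF bounded_linear_vec_nth]
        matrix_vector_mul_bounded_linear)
  have "((\<lambda>y. \<Sum>l\<in>UNIV. (G *v y) $ l * L y (axis l 1)) has_derivative
      (\<lambda>h. (\<Sum>l\<in>UNIV. (G *v x) $ l * H (axis l 1) h + (G *v h) $ l * L x (axis l 1)))) (at x)"
    by (intro has_derivative_sum has_derivative_mult dG dL)
  from has_derivative_transform_within_open[OF this assms(1,2)]
  have "(lin_vf G F has_derivative
      (\<lambda>h. (\<Sum>l\<in>UNIV. (G *v x) $ l * H (axis l 1) h + (G *v h) $ l * L x (axis l 1)))) (at x)"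
    using bil lin_vf_eq_derivative[OF dF] by simp
  from lin_vf_eq_derivative[OF this]
  have *: "lin_vf E (lin_vf G F) x = (\<Sum>l\<in>UNIV. (G *v x) $ l * H (axis l 1) (E *v x)) + L x (G *v (E *v x))"
    by (simp add: sum.distrib bil[OF assms(2), symmetric])
  \<comment> \<open>The coordinate sum is reassembled: it and \<open>H (G *v x)\<close> are
    derivatives of the same function, the one with direction frozen at \<open>G *v x\<close>, so
    they agree by uniqueness.\<close>
  have "((\<lambda>z. \<Sum>l\<in>UNIV. (G *v x) $ l * L z (axis l 1)) has_derivative
      (\<lambda>h. \<Sum>l\<in>UNIV. (G *v x) $ l * H (axis l 1) h)) (at x)"
    by (intro has_derivative_sum has_derivative_mult_right dL)
  from has_derivative_transform_within_open[OF this assms(1,2)]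
  have "((\<lambda>z. L z (G *v x)) has_derivative (\<lambda>h. \<Sum>l\<in>UNIV. (G *v x) $ l * H (axis l 1) h)) (at x)"
    using bil by simp
  from has_derivative_unique[OF this dL] have "H (G *v x) = (\<lambda>h. \<Sum>l\<in>UNIV. (G *v x) $ l * H (axis l 1) h)"
    by simp
  with * show ?thesis by (simp add: H_def L_def)
qed

text \<open>Turns identities at a point into linear algebra: \<open>L\<close> and \<open>H\<close>
  are the first and second derivatives at \<open>x\<close> of one local extension of
  \<open>f\<close>, the same for all matrices. In the last term the outer field \<open>E\<close> has
  differentiated the coefficient \<open>G *v x\<close>, which is why the matrix product appears in
  reversed order.\<close>

lemma sphere_vf_jet:
  fixes f :: "real^'n \<Rightarrow> real"
  assumes "smooth_on_sphere f" and x: "x \<in> sphere 0 1"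
  shows "\<exists>H L. linear L \<and> (\<forall>u. linear (H u)) \<and> (\<forall>u v. H u v = H v u) \<and>
    (\<forall>E. skew E \<longrightarrow> sphere_vf E f x = L (E *v x)) \<and>
    (\<forall>E G. skew E \<longrightarrow> skew G \<longrightarrow>
      sphere_vf E (sphere_vf G f) x = H (E *v x) (G *v x) + L (G *v (E *v x)))"
proof -
  obtain U F where U: "open U" "x \<in> U" "smooth_on U F" "\<And>y. y \<in> U \<inter> sphere 0 1 \<Longrightarrow> f y = F y"
    using smooth_on_sphereD[OF assms] by blast
  define L where "L = frechet_derivative F (at x)"
  define H where "H = (\<lambda>u. frechet_derivative (\<lambda>z. frechet_derivative F (at z) u) (at x))"
  have dF: "(F has_derivative L) (at x)"
    unfolding L_def using U smooth_on_differentiable frechet_derivative_works by blast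
  have loc: "sphere_vf G f y = lin_vf G F y" if "skew G" "y \<in> U \<inter> sphere 0 1" for G y
    using sphere_vf_local[OF that(1) U(1,3,4) that(2)] .
  have sym: "H u v = H v u" for u v
    unfolding H_def by (rule symmetric_second_derivative[OF U(1-3)])
  have linH: "linear (H u)" for u
    unfolding H_def using smooth_on_differentiable[OF smooth_on_derivative[OF U(3)] U(2)]
    by (rule linear_frechet_derivative)
  have first: "sphere_vf E f x = L (E *v x)" if "skew E" for E
    using loc[OF that] U(2) x lin_vf_eq_derivative[OF dF] by simp
  have second: "sphere_vf E (sphere_vf G f) x = H (E *v x) (G *v x) + L (G *v (E *v x))"
    if "skew E" "skew G" for E G
  proof -
    have "sphere_vf E (sphere_vf G f) x = lin_vf E (lin_vf G F) x"
      using U x loc[OF that(2)]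
      by (intro sphere_vf_local[OF that(1) U(1)]) (auto intro: smooth_on_lin_vf)
    also have "\<dots> = H (G *v x) (E *v x) + L (G *v (E *v x))"
      unfolding H_def L_def by (rule lin_vf_lin_vf[OF U(1-3)])
    finally show ?thesis using sym by simp
  qed
  show ?thesis
    using has_derivative_linear[OF dF] linH sym first second by blast
qed

lemma skew_uminus: "skew (- A) \<longleftrightarrow> skew A"
proof -
  have "transpose (- A) = - transpose A"
    by (simp add: transpose_def vec_eq_iff)
  then show ?thesis unfolding skew_def by (metis minus_minus)
qed

lemma sphere_vf_uminus:
  fixes A :: "real^'n^'n"
  assumes "skew A" "smooth_on_sphere f" "x \<in> sphere 0 1"
  shows "sphere_vf (- A) f x = - sphere_vf A f x"
proof -
  obtain L where "linear L" and L: "\<And>E. skew E \<Longrightarrow> sphere_vf E f x = L (E *v x)"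
    using sphere_vf_jet[OF assms(2,3)] by blast
  have "- A *v x = - (A *v x)"
    by (simp add: matrix_vector_mult_def vec_eq_iff sum_negf)
  then show ?thesis
    using L assms(1) \<open>linear L\<close> by (simp add: skew_uminus linear_neg)
qed

section \<open>Commutators of fields and the cancellation criterion for sums of squares\<close>

section \<open>Sums of squares\<close>

lemma matrix_mult_minus_left: "(- A) ** B = - (A ** (B :: real^'n^'n) :: real^'n^'n)"
  by (simp add: matrix_matrix_mult_def vec_eq_iff sum_negf)

lemma matrix_mult_minus_right: "A ** (- B) = - (A ** (B :: real^'n^'n) :: real^'n^'n)"
  by (simp add: matrix_matrix_mult_def vec_eq_iff sum_negf)

lemma matrix_vector_mult_minus_left: "(- A) *v x = - (A *v (x :: real^'n) :: real^'n)"
  by (simp add: matrix_vector_mult_def vec_eq_iff sum_negf)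

lemma skew_mult_anticommute:
  fixes A :: "real^'n^'n"
  assumes "skew A" "skew B" "A ** B = - (B ** A)"
  shows "skew (A ** B)"
proof -
  have "transpose (A ** B) = B ** A"
    using assms(1,2)
    by (simp add: skew_def matrix_transpose_mul matrix_mult_minus_left matrix_mult_minus_right)
  then show ?thesis using assms(3) by (simp add: skew_def)
qed

lemma sphere_vf_commute:
  fixes f :: "real^'n \<Rightarrow> real"
  assumes "skew E" "skew B" "E ** B = B ** E" "smooth_on_sphere f" "x \<in> sphere 0 1"
  shows "sphere_vf E (sphere_vf B f) x = sphere_vf B (sphere_vf E f) x"
proof -
  have "E *v (B *v x) = B *v (E *v x)"
    using assms(3) by (simp add: matrix_vector_mul_assoc)
  then show ?thesis
    using sphere_vf_jet[OF assms(4,5)] assms(1,2) by metis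
qed

text \<open>In terms of the jet at \<open>x\<close>, the two \<open>H\<close> terms agree by
  symmetry. The difference of the \<open>L\<close> terms is L(BEx) - L(EBx), which anticommutation
  turns into 2 L(BEx).\<close>

lemma sphere_vf_anticommute:
  fixes f :: "real^'n \<Rightarrow> real"
  assumes "skew E" "skew B" "E ** B = - (B ** E)" "smooth_on_sphere f" "x \<in> sphere 0 1"
  shows "sphere_vf E (sphere_vf B f) x = sphere_vf B (sphere_vf E f) x + 2 * sphere_vf (B ** E) f x"
proof -
  obtain H L where "linear L" and H: "\<And>u v. H u v = H v u"
    and L: "\<And>E. skew E \<Longrightarrow> sphere_vf E f x = L (E *v x)"
    and HL: "\<And>E G. skew E \<Longrightarrow> skew G \<Longrightarrow>
      sphere_vf E (sphere_vf G f) x = H (E *v x) (G *v x) + L (G *v (E *v x))"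
    using sphere_vf_jet[OF assms(4,5)] by blast
  have "B ** E = - (E ** B)" using assms(3) by simp
  then have "skew (B ** E)"
    by (rule skew_mult_anticommute[OF assms(2,1)])
  moreover have "L (E *v (B *v x)) = - L (B *v (E *v x))"
    using assms(3) linear_neg[OF \<open>linear L\<close>]
    by (simp add: matrix_vector_mul_assoc matrix_vector_mult_minus_left)
  ultimately show ?thesis
    using H[of "E *v x" "B *v x"] by (simp add: HL L assms matrix_vector_mul_assoc)
qed

definition sumsq :: "(real^'n^'n) set \<Rightarrow> (real^'n \<Rightarrow> real) \<Rightarrow> real^'n \<Rightarrow> real" where
  "sumsq T f x = (\<Sum>E\<in>T. sphere_vf E (sphere_vf E f) x)"

lemma smooth_on_sphere_sumsq:
  assumes "\<And>E. E \<in> T \<Longrightarrow> skew E" "smooth_on_sphere f"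
  shows "smooth_on_sphere (sumsq T f)"
  unfolding sumsq_def using assms
  by (intro smooth_on_sphere_sum smooth_on_sphere_vf) auto

lemma sphere_vf_sphere_vf_cong:
  fixes f :: "real^'n \<Rightarrow> real"
  assumes "skew E" "skew G" "smooth_on_sphere f" "\<And>y. y \<in> sphere 0 1 \<Longrightarrow> f y = g y" "x \<in> sphere 0 1"
  shows "sphere_vf G (sphere_vf E f) x = sphere_vf G (sphere_vf E g) x"
  by (intro sphere_vf_cong smooth_on_sphere_vf assms)

lemma sumsq_cong:
  assumes "\<And>E. E \<in> T \<Longrightarrow> skew E" "smooth_on_sphere f" "\<And>y. y \<in> sphere 0 1 \<Longrightarrow> f y = g y"
    "x \<in> sphere 0 1"
  shows "sumsq T f x = sumsq T g x"
  unfolding sumsq_def by (intro sum.cong refl sphere_vf_sphere_vf_cong assms)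

lemma sumsq_sum:
  assumes T: "\<And>E. E \<in> T \<Longrightarrow> skew E" and f: "\<And>i. i \<in> I \<Longrightarrow> smooth_on_sphere (f i)"
    and x: "x \<in> sphere 0 1"
  shows "sumsq T (\<lambda>y. \<Sum>i\<in>I. f i y) x = (\<Sum>i\<in>I. sumsq T (f i) x)"
proof -
  have "sphere_vf E (sphere_vf E (\<lambda>y. \<Sum>i\<in>I. f i y)) x = (\<Sum>i\<in>I. sphere_vf E (sphere_vf E (f i)) x)"
    if "E \<in> T" for E
  proof -
    have "sphere_vf E (sphere_vf E (\<lambda>y. \<Sum>i\<in>I. f i y)) x =
        sphere_vf E (\<lambda>y. \<Sum>i\<in>I. sphere_vf E (f i) y) x"
      by (intro sphere_vf_cong sphere_vf_sum smooth_on_sphere_vf smooth_on_sphere_sum T f that x)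
    also have "\<dots> = (\<Sum>i\<in>I. sphere_vf E (sphere_vf E (f i)) x)"
      by (intro sphere_vf_sum smooth_on_sphere_vf T f that x)
    finally show ?thesis .
  qed
  then have "sumsq T (\<lambda>y. \<Sum>i\<in>I. f i y) x = (\<Sum>E\<in>T. \<Sum>i\<in>I. sphere_vf E (sphere_vf E (f i)) x)"
    by (simp add: sumsq_def)
  then show ?thesis unfolding sumsq_def by (simp only: sum.swap[of _ I T])
qed

lemma sumsq_add:
  assumes T: "\<And>E. E \<in> T \<Longrightarrow> skew E" and f: "smooth_on_sphere f" "smooth_on_sphere g"
    and x: "x \<in> sphere 0 1"
  shows "sumsq T (\<lambda>y. f y + g y) x = sumsq T f x + sumsq T g x"
  \<comment> \<open>A sum of two functions is a sum indexed by \<open>bool\<close>.\<close>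
  using sumsq_sum[of T "UNIV :: bool set" "\<lambda>b. if b then f else g" x] assms
  by (simp add: UNIV_bool add.commute)

lemma sphere_vf_sphere_vf_cmult:
  fixes E :: "real^'n^'n"
  assumes "skew E" "skew G" "smooth_on_sphere f" "x \<in> sphere 0 1"
  shows "sphere_vf G (sphere_vf E (\<lambda>y. c * f y)) x = c * sphere_vf G (sphere_vf E f) x"
proof -
  have "sphere_vf G (sphere_vf E (\<lambda>y. c * f y)) x = sphere_vf G (\<lambda>y. c * sphere_vf E f y) x"
    by (intro sphere_vf_cong sphere_vf_cmult smooth_on_sphere_vf smooth_on_sphere_cmult assms)
  also have "\<dots> = c * sphere_vf G (sphere_vf E f) x"
    by (intro sphere_vf_cmult smooth_on_sphere_vf assms)
  finally show ?thesis .
qed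

lemma sumsq_cmult:
  assumes "\<And>E. E \<in> T \<Longrightarrow> skew E" "smooth_on_sphere f" "x \<in> sphere 0 1"
  shows "sumsq T (\<lambda>y. c * f y) x = c * sumsq T f x"
  unfolding sumsq_def using assms by (simp add: sphere_vf_sphere_vf_cmult sum_distrib_left)

lemma sphere_vf_sphere_vf_uminus:
  fixes E :: "real^'n^'n"
  assumes "skew E" "skew G" "smooth_on_sphere f" "x \<in> sphere 0 1"
  shows "sphere_vf G (sphere_vf (- E) f) x = - sphere_vf G (sphere_vf E f) x"
proof -
  have "sphere_vf G (sphere_vf (- E) f) x = sphere_vf G (\<lambda>y. (-1) * sphere_vf E f y) x"
    using assms by (intro sphere_vf_cong smooth_on_sphere_vf) (auto simp: skew_uminus sphere_vf_uminus)
  also have "\<dots> = (-1) * sphere_vf G (sphere_vf E f) x"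
    by (intro sphere_vf_cmult smooth_on_sphere_vf assms)
  finally show ?thesis by simp
qed

text \<open>A sign drops out of a square, and the condition on negatives keeps the union disjoint.
  This links the generating sets, which hold one matrix of each pair E, -E, with the sign-symmetric
  sets on which left multiplication acts.\<close>

lemma sumsq_Un_uminus:
  fixes T :: "(real^'n^'n) set"
  assumes "finite T" "\<And>E. E \<in> T \<Longrightarrow> skew E" "\<And>E. E \<in> T \<Longrightarrow> - E \<notin> T"
    and f: "smooth_on_sphere f" "x \<in> sphere 0 1"
  shows "sumsq (T \<union> uminus ` T) f x = 2 * sumsq T f x"
proof -
  have "T \<inter> uminus ` T = {}" using assms(3) by auto
  then have "sumsq (T \<union> uminus ` T) f x = sumsq T f x + sumsq (uminus ` T) f x"
    unfolding sumsq_def using assms(1) by (intro sum.union_disjoint) auto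
  also have "sumsq (uminus ` T) f x = (\<Sum>E\<in>T. sphere_vf (- E) (sphere_vf (- E) f) x)"
    unfolding sumsq_def by (subst sum.reindex) auto
  also have "\<dots> = sumsq T f x"
    unfolding sumsq_def
  proof (rule sum.cong[OF refl])
    fix E assume "E \<in> T"
    then have E: "skew E" "skew (- E)" using assms(2) skew_uminus by auto
    show "sphere_vf (- E) (sphere_vf (- E) f) x = sphere_vf E (sphere_vf E f) x"
      using sphere_vf_sphere_vf_uminus[OF E f] sphere_vf_uminus[OF E(1) smooth_on_sphere_vf[OF E(1) f(1)] f(2)]
      by simp
  qed
  finally show ?thesis by simp
qed

text \<open>Closure is demanded only where a nonzero commutator can arise. It makes left
  multiplication by \<open>B\<close> act on the elements anticommuting with \<open>B\<close>; when
  B^2 = -1, applying it twice gives E to -E.\<close>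

definition adapted :: "(real^'n^'n) set \<Rightarrow> real^'n^'n \<Rightarrow> bool" where
  "adapted T B \<longleftrightarrow> (\<forall>E\<in>T. E ** B = B ** E \<or> (E ** B = - (B ** E) \<and> B ** E \<in> T))"

text \<open>Moving X(B) to the left across X(E)^2 leaves 2 t(E), where t(E) is the symmetrized
  product of X(E) and X(BE). Since B(BE) = -E, t(BE) = -t(E). The map from E to BE permutes the
  anticommuting elements \<open>N\<close>, so the sum of t over \<open>N\<close> equals its own
  negative and vanishes.\<close>

lemma sumsq_sphere_vf:
  fixes T :: "(real^'n^'n) set"
  assumes T: "finite T" "\<And>E. E \<in> T \<Longrightarrow> skew E" and B: "skew B" "B ** B = - mat 1"
    and "adapted T B" and f: "smooth_on_sphere f" and x: "x \<in> sphere 0 1"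
  shows "sumsq T (sphere_vf B f) x = sphere_vf B (sumsq T f) x"
proof -
  define N where "N = {E \<in> T. E ** B = - (B ** E)}"
  define t where "t = (\<lambda>E. sphere_vf E (sphere_vf (B ** E) f) x + sphere_vf (B ** E) (sphere_vf E f) x)"
  note sm = smooth_on_sphere_vf smooth_on_sphere_add smooth_on_sphere_cmult
  have BB: "B ** (B ** E) = - E" for E :: "real^'n^'n"
    using B(2) by (simp add: matrix_mul_assoc matrix_mult_minus_left)
  have skC: "skew (B ** E)" if "E \<in> N" for E
  proof (rule skew_mult_anticommute[OF B(1)])
    show "skew E" "B ** E = - (E ** B)" using that T(2) by (auto simp: N_def)
  qed
  have comm: "sphere_vf E (sphere_vf E (sphere_vf B f)) x = sphere_vf B (sphere_vf E (sphere_vf E f)) x"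
    if "E \<in> T" "E \<notin> N" for E
  proof -
    have E: "skew E" "E ** B = B ** E"
      using that T(2) assms(5) by (auto simp: N_def adapted_def)
    have "sphere_vf E (sphere_vf E (sphere_vf B f)) x = sphere_vf E (sphere_vf B (sphere_vf E f)) x"
      by (intro sphere_vf_cong sphere_vf_commute sm E B f x)
    also have "\<dots> = sphere_vf B (sphere_vf E (sphere_vf E f)) x"
      by (intro sphere_vf_commute sm E B f x)
    finally show ?thesis .
  qed
  \<comment> \<open>X(B) crosses the two factors X(E) one at a time. Each crossing leaves 2 X(BE),
    once to the right and once to the left of the other factor X(E).\<close>
  have anti: "sphere_vf E (sphere_vf E (sphere_vf B f)) x =
      sphere_vf B (sphere_vf E (sphere_vf E f)) x + 2 * t E" if "E \<in> N" for E
  proof -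
    have E: "skew E" "E ** B = - (B ** E)"
      using that T(2) by (auto simp: N_def)
    have "sphere_vf E (sphere_vf E (sphere_vf B f)) x =
        sphere_vf E (\<lambda>y. sphere_vf B (sphere_vf E f) y + 2 * sphere_vf (B ** E) f y) x"
      by (intro sphere_vf_cong sphere_vf_anticommute sm E B f x)
    also have "\<dots> = sphere_vf E (sphere_vf B (sphere_vf E f)) x + 2 * sphere_vf E (sphere_vf (B ** E) f) x"
      using sphere_vf_add[OF E(1) _ _ x] sphere_vf_cmult[OF E(1) _ x]
      by (simp add: sm E B f skC that)
    also have "sphere_vf E (sphere_vf B (sphere_vf E f)) x =
        sphere_vf B (sphere_vf E (sphere_vf E f)) x + 2 * sphere_vf (B ** E) (sphere_vf E f) x"
      by (intro sphere_vf_anticommute sm E B f x)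
    finally show ?thesis by (simp add: t_def)
  qed
  \<comment> \<open>Injective because B^2 = -1; surjectivity onto \<open>N\<close> then follows from
    finiteness.\<close>
  have bij: "bij_betw ((**) B) N N"
  proof -
    have inj: "inj_on ((**) B) N" by (rule inj_onI) (metis BB minus_equation_iff)
    have "((**) B) ` N \<subseteq> N"
    proof
      fix C assume "C \<in> (**) B ` N"
      then obtain E where E: "E \<in> N" "C = B ** E" by auto
      then have EB: "E \<in> T" "E ** B = - (B ** E)" by (auto simp: N_def)
      have "C ** B = - (B ** C)"
        using EB E by (simp add: matrix_mul_assoc[symmetric] matrix_mult_minus_right)
      moreover have "C \<in> T"
      proof (cases "E ** B = B ** E")
        \<comment> \<open>Commuting and anticommuting at once forces \<open>E = 0\<close>. Then
          \<open>C\<close> is 0 as well and lies in \<open>T\<close> because \<open>E\<close>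
          does.\<close>
        case True
        then have "B ** E = - (B ** E)" using EB(2) by simp
        then have "B ** E = 0" by (simp add: vec_eq_iff)
        then have "E = 0" using BB[of E] by simp
        then show ?thesis using EB(1) E(2) by simp
      next
        case False
        then show ?thesis using assms(5) EB E by (auto simp: adapted_def)
      qed
      ultimately show "C \<in> N" by (simp add: N_def)
    qed
    then show ?thesis
      using inj T(1) by (simp add: bij_betw_def N_def endo_inj_surj)
  qed
  have "(\<Sum>E\<in>N. t E) = (\<Sum>E\<in>N. t (B ** E))"
    using sum.reindex_bij_betw[OF bij, of t] by simp
  also have "\<dots> = (\<Sum>E\<in>N. - t E)"
  proof (rule sum.cong[OF refl])
    fix E assume E: "E \<in> N"
    then have sE: "skew E" using T(2) by (simp add: N_def)
    \<comment> \<open>Replacing \<open>E\<close> by \<open>B ** E\<close> replaces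
      \<open>B ** E\<close> by \<open>- E\<close>: both products in \<open>t\<close> reappear in the
      other order with a minus sign.\<close>
    show "t (B ** E) = - t E"
      unfolding t_def BB
      using sphere_vf_sphere_vf_uminus[OF sE skC[OF E] f x]
        sphere_vf_uminus[OF sE smooth_on_sphere_vf[OF skC[OF E] f] x] by simp
  qed
  finally have t0: "(\<Sum>E\<in>N. t E) = 0" by (simp add: sum_negf)
  have "sumsq T (sphere_vf B f) x =
      (\<Sum>E\<in>T. sphere_vf B (sphere_vf E (sphere_vf E f)) x + (if E \<in> N then 2 * t E else 0))"
    unfolding sumsq_def by (intro sum.cong refl) (use comm anti in auto)
  also have "\<dots> = (\<Sum>E\<in>T. sphere_vf B (sphere_vf E (sphere_vf E f)) x) + 2 * (\<Sum>E\<in>N. t E)"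
  proof -
    have "T \<inter> N = N" by (auto simp: N_def)
    then show ?thesis
      using T(1) by (simp add: sum.distrib sum_distrib_left flip: sum.inter_restrict)
  qed
  also have "\<dots> = (\<Sum>E\<in>T. sphere_vf B (sphere_vf E (sphere_vf E f)) x)"
    by (simp add: t0)
  also have "\<dots> = sphere_vf B (sumsq T f) x"
    unfolding sumsq_def by (intro sphere_vf_sum[symmetric] sm T B f x)
  finally show ?thesis .
qed

text \<open>Reduces two second-order operators to a first-order condition: the sum over
  \<open>S\<close> is moved past the two factors X(B) of each square in turn. The condition is
  stated for every smooth \<open>g\<close> because it is applied both to \<open>f\<close> and to
  X(B)f.\<close>

lemma sumsq_commute:
  assumes T: "\<And>E. E \<in> T \<Longrightarrow> skew E" and S: "\<And>E. E \<in> S \<Longrightarrow> skew E"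
    and comm: "\<And>B g y. B \<in> T \<Longrightarrow> smooth_on_sphere g \<Longrightarrow> y \<in> sphere 0 1 \<Longrightarrow>
      sumsq S (sphere_vf B g) y = sphere_vf B (sumsq S g) y"
    and f: "smooth_on_sphere f" and x: "x \<in> sphere 0 1"
  shows "sumsq S (sumsq T f) x = sumsq T (sumsq S f) x"
proof -
  note sm = smooth_on_sphere_vf smooth_on_sphere_sumsq
  have "sumsq S (sumsq T f) x = sumsq S (\<lambda>y. \<Sum>B\<in>T. sphere_vf B (sphere_vf B f) y) x"
    by (simp add: sumsq_def[of T f, abs_def])
  also have "\<dots> = (\<Sum>B\<in>T. sumsq S (sphere_vf B (sphere_vf B f)) x)"
    by (intro sumsq_sum sm S T f x)
  also have "\<dots> = (\<Sum>B\<in>T. sphere_vf B (sphere_vf B (sumsq S f)) x)"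
  proof (rule sum.cong[OF refl])
    fix B assume B: "B \<in> T"
    have "sumsq S (sphere_vf B (sphere_vf B f)) x = sphere_vf B (sumsq S (sphere_vf B f)) x"
      by (intro comm sm B T f x)
    also have "\<dots> = sphere_vf B (sphere_vf B (sumsq S f)) x"
      by (intro sphere_vf_cong comm sm B T S f x)
    finally show "sumsq S (sphere_vf B (sphere_vf B f)) x = sphere_vf B (sphere_vf B (sumsq S f)) x" .
  qed
  also have "\<dots> = sumsq T (sumsq S f) x" by (simp add: sumsq_def)
  finally show ?thesis .
qed

section \<open>Sign rules in the Clifford algebra and adaptedness of products of generators\<close>

section \<open>Clifford families\<close>

lemma neg_eq_iff_eq_neg: "- X = Y \<longleftrightarrow> X = - (Y :: 'a::group_add)"
  by (metis minus_minus)

lemma adapted_Un: "adapted S B \<Longrightarrow> adapted T B \<Longrightarrow> adapted (S \<union> T) B"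
  by (auto simp: adapted_def)

lemma adapted_commute: "(\<And>E. E \<in> T \<Longrightarrow> E ** B = B ** E) \<Longrightarrow> adapted T B"
  by (simp add: adapted_def)

text \<open>For two generators the product BE is in general a generator only up to sign, so
  adaptedness is imposed on the sign-symmetric set. Its sum of squares is twice the one over
  \<open>T\<close>, and the factor cancels.\<close>

lemma sumsq_sphere_vf_signed:
  fixes T :: "(real^'n^'n) set"
  assumes T: "finite T" "\<And>E. E \<in> T \<Longrightarrow> skew E" "\<And>E. E \<in> T \<Longrightarrow> - E \<notin> T"
    and B: "skew B" "B ** B = - mat 1"
    and ad: "adapted (T \<union> uminus ` T) B" and f: "smooth_on_sphere f" and x: "x \<in> sphere 0 1"
  shows "sumsq T (sphere_vf B f) x = sphere_vf B (sumsq T f) x"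
proof -
  have T': "skew E" if "E \<in> T \<union> uminus ` T" for E
    using that T(2) by (auto simp: skew_uminus)
  have eq: "sumsq (T \<union> uminus ` T) g y = 2 * sumsq T g y"
    if "smooth_on_sphere g" "y \<in> sphere 0 1" for g y
    using that T by (intro sumsq_Un_uminus)
  have "2 * sumsq T (sphere_vf B f) x = sumsq (T \<union> uminus ` T) (sphere_vf B f) x"
    by (intro eq[symmetric] smooth_on_sphere_vf B f x)
  also have "\<dots> = sphere_vf B (sumsq (T \<union> uminus ` T) f) x"
    using T(1) by (intro sumsq_sphere_vf T' B ad f x) auto
  also have "\<dots> = sphere_vf B (\<lambda>y. 2 * sumsq T f y) x"
    by (intro sphere_vf_cong smooth_on_sphere_sumsq T' eq B f x)
  also have "\<dots> = 2 * sphere_vf B (sumsq T f) x"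
    by (intro sphere_vf_cmult smooth_on_sphere_sumsq T B f x)
  finally show ?thesis by simp
qed

text \<open>This lemma and the next three are the sign rule: moving \<open>P\<close> across a
  product multiplies the signs picked up from the two factors.\<close>

lemma commute_mult:
  fixes P :: "real^'n^'n"
  assumes "P ** M = M ** P" "P ** N = N ** P"
  shows "P ** (M ** N) = (M ** N) ** P"
  by (metis assms matrix_mul_assoc)

lemma anticommute_mult:
  fixes P :: "real^'n^'n"
  assumes "P ** M = - (M ** P)" "P ** N = - (N ** P)"
  shows "P ** (M ** N) = (M ** N) ** P"
proof -
  have "P ** (M ** N) = - (M ** (P ** N))"
    using assms(1) by (simp add: matrix_mul_assoc matrix_mult_minus_left)
  then show ?thesis
    using assms(2) by (simp add: matrix_mul_assoc matrix_mult_minus_right)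
qed

lemma commute_anticommute_mult:
  fixes P :: "real^'n^'n"
  assumes "P ** M = M ** P" "P ** N = - (N ** P)"
  shows "P ** (M ** N) = - ((M ** N) ** P)"
proof -
  have "P ** (M ** N) = M ** (P ** N)"
    using assms(1) by (simp add: matrix_mul_assoc)
  then show ?thesis
    using assms(2) by (simp add: matrix_mul_assoc matrix_mult_minus_right)
qed

lemma anticommute_commute_mult:
  fixes P :: "real^'n^'n"
  assumes "P ** M = - (M ** P)" "P ** N = N ** P"
  shows "P ** (M ** N) = - ((M ** N) ** P)"
proof -
  have "P ** (M ** N) = - (M ** (P ** N))"
    using assms(1) by (simp add: matrix_mul_assoc matrix_mult_minus_left)
  then show ?thesis
    using assms(2) by (simp add: matrix_mul_assoc)
qed

definition pairs :: "(nat \<Rightarrow> real^8^8) \<Rightarrow> nat set \<Rightarrow> (real^8^8) set" where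
  "pairs A I = {A i ** A j | i j. i \<in> I \<and> j \<in> I \<and> i \<noteq> j}"

definition singles :: "(nat \<Rightarrow> real^8^8) \<Rightarrow> nat set \<Rightarrow> (real^8^8) set" where
  "singles A I = A ` I \<union> uminus ` A ` I"

context
  fixes A :: "nat \<Rightarrow> real^8^8"
  assumes cliff: "clifford_family A"
begin

lemma clifford_skew: "i \<in> {1..7} \<Longrightarrow> skew (A i)"
  using cliff by (simp add: clifford_family_def)

lemma clifford_relation:
  assumes "i \<in> {1..7}" "j \<in> {1..7}"
  shows "A i ** A j + A j ** A i = (if i = j then - 2 else 0) *\<^sub>R mat 1"
  using cliff assms unfolding clifford_family_def by blast

lemma clifford_square:
  assumes "i \<in> {1..7}"
  shows "A i ** A i = - mat 1"
proof -
  have "2 *\<^sub>R (A i ** A i) = 2 *\<^sub>R (- mat 1)"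
    using clifford_relation[OF assms assms] by (simp add: scaleR_2)
  then show ?thesis unfolding scaleR_cancel_left by simp
qed

lemma clifford_anticommute:
  assumes "i \<in> {1..7}" "j \<in> {1..7}" "i \<noteq> j"
  shows "A i ** A j = - (A j ** A i)"
  using clifford_relation[OF assms(1,2)] assms(3) by (simp add: eq_neg_iff_add_eq_0)

lemma clifford_square_left: "i \<in> {1..7} \<Longrightarrow> A i ** (A i ** M) = - (M :: real^8^8)"
  by (simp add: matrix_mul_assoc clifford_square matrix_mult_minus_left)

lemma clifford_commute_pair:
  assumes "i \<in> {1..7}" "j \<in> {1..7}" "k \<in> {1..7}" "i \<noteq> k" "j \<noteq> k"
  shows "A k ** (A i ** A j) = (A i ** A j) ** A k"
  using assms by (intro anticommute_mult clifford_anticommute) auto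

lemma clifford_anticommute_pair:
  assumes "i \<in> {1..7}" "j \<in> {1..7}" "i \<noteq> j"
  shows "A i ** (A i ** A j) = - ((A i ** A j) ** A i)" "A j ** (A i ** A j) = - ((A i ** A j) ** A j)"
proof -
  show "A i ** (A i ** A j) = - ((A i ** A j) ** A i)"
    by (rule commute_anticommute_mult[OF refl clifford_anticommute[OF assms]])
  show "A j ** (A i ** A j) = - ((A i ** A j) ** A j)"
    by (rule anticommute_commute_mult[OF clifford_anticommute[OF assms(2,1) assms(3)[symmetric]] refl])
qed

lemma clifford_skew_pair:
  assumes "i \<in> {1..7}" "j \<in> {1..7}" "i \<noteq> j"
  shows "skew (A i ** A j)"
  using assms by (intro skew_mult_anticommute clifford_skew clifford_anticommute)

lemma clifford_square_pair:
  assumes "i \<in> {1..7}" "j \<in> {1..7}" "i \<noteq> j"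
  shows "(A i ** A j) ** (A i ** A j) = - mat 1"
proof -
  have "(A i ** A j) ** (A i ** A j) = A i ** (A j ** (A i ** A j))"
    by (simp add: matrix_mul_assoc)
  also have "\<dots> = - (A i ** (A i ** (A j ** A j)))"
    unfolding clifford_anticommute_pair(2)[OF assms]
    by (simp add: matrix_mul_assoc[symmetric] matrix_mult_minus_right)
  finally show ?thesis using assms by (simp add: clifford_square_left clifford_square)
qed

lemma pairs_uminus: "I \<subseteq> {1..7} \<Longrightarrow> E \<in> pairs A I \<Longrightarrow> - E \<in> pairs A I"
proof -
  assume I: "I \<subseteq> {1..7}" and "E \<in> pairs A I"
  then obtain i j where ij: "i \<in> I" "j \<in> I" "i \<noteq> j" "E = A i ** A j"
    by (auto simp: pairs_def)
  then have "- E = A j ** A i"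
    using clifford_anticommute[OF subsetD[OF I ij(2)] subsetD[OF I ij(1)]] by auto
  then show "- E \<in> pairs A I"
    using ij by (auto simp: pairs_def)
qed

lemma singles_uminus: "E \<in> singles A I \<Longrightarrow> - E \<in> singles A I"
  by (auto simp: singles_def)

text \<open>An \<open>A k\<close> with \<open>k\<close> outside \<open>I\<close> changes sign at
  each of the two factors of \<open>B\<close>, hence commutes with \<open>B\<close>; products of
  such \<open>A k\<close> do too.\<close>

lemma pairs_commute_disjoint:
  assumes I: "I \<subseteq> {1..7}" and J: "J \<subseteq> {1..7}" and disj: "I \<inter> J = {}"
    and B: "B \<in> pairs A I" and E: "E \<in> pairs A J \<union> singles A J"
  shows "E ** B = B ** E"
proof -
  obtain i j where ij: "i \<in> I" "j \<in> I" "B = A i ** A j"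
    using B by (auto simp: pairs_def)
  have 1: "A k ** B = B ** A k" if "k \<in> J" for k
    unfolding ij(3) using that ij(1,2) disj
    by (intro clifford_commute_pair subsetD[OF I] subsetD[OF J]) auto
  then have "(A k ** A l) ** B = B ** (A k ** A l)" if "k \<in> J" "l \<in> J" for k l
    using that by (intro commute_mult[symmetric]) auto
  then show ?thesis
    using E 1 by (auto simp: pairs_def singles_def matrix_mult_minus_left matrix_mult_minus_right)
qed

lemma single_commute_pairs_disjoint:
  assumes J: "J \<subseteq> {1..7}" and i: "i \<in> {1..7}" "i \<notin> J" and E: "E \<in> pairs A J"
  shows "E ** A i = A i ** E"
proof -
  obtain k l where kl: "k \<in> J" "l \<in> J" "E = A k ** A l"
    using E by (auto simp: pairs_def)
  then have "k \<in> {1..7}" "l \<in> {1..7}" "k \<noteq> i" "l \<noteq> i"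
    using J i by blast+
  from clifford_commute_pair[OF this(1,2) i(1) this(3,4)] show ?thesis
    by (simp add: kl(3))
qed

text \<open>Products over disjoint or equal index pairs commute. If exactly one index is shared,
  they anticommute, and up to sign the situation is \<open>chain\<close>: A_p A_q A_q A_r = -A_p A_r
  = A_r A_p, again a pair product.\<close>

lemma adapted_pairs:
  assumes I: "I \<subseteq> {1..7}" and ij: "i \<in> I" "j \<in> I" "i \<noteq> j"
  shows "adapted (pairs A I) (A i ** A j)"
  unfolding adapted_def
proof
  fix E assume "E \<in> pairs A I"
  then obtain k l where kl: "k \<in> I" "l \<in> I" "k \<noteq> l" "E = A k ** A l"
    by (auto simp: pairs_def)
  define good where "good = (\<lambda>E B. E ** B = B ** E \<or> (E ** B = - (B ** E) \<and> B ** E \<in> pairs A I))"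
  have neg: "- M \<in> pairs A I \<longleftrightarrow> M \<in> pairs A I" for M
    using pairs_uminus[OF I, of M] pairs_uminus[OF I, of "- M"] by auto
  have good_uminus: "good (- E) B = good E B" "good E (- B) = good E B" for E B
    by (simp_all add: good_def matrix_mult_minus_left matrix_mult_minus_right neg neg_eq_iff_eq_neg)
  have swap: "A p ** A q = - (A q ** A p)" if "p \<in> I" "q \<in> I" "p \<noteq> q" for p q
    using that I by (intro clifford_anticommute) auto
  have chain: "good (A q ** A r) (A p ** A q)"
    if "p \<in> I" "q \<in> I" "r \<in> I" "p \<noteq> q" "q \<noteq> r" "p \<noteq> r" for p q r
  proof -
    have m: "p \<in> {1..7}" "q \<in> {1..7}" "r \<in> {1..7}" using that I by auto
    have "(A p ** A q) ** (A q ** A r) = A p ** (A q ** (A q ** A r))"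
      by (simp add: matrix_mul_assoc)
    also have "\<dots> = A r ** A p"
      using swap[of p r] that m by (simp add: clifford_square_left matrix_mult_minus_right)
    finally have "(A p ** A q) ** (A q ** A r) \<in> pairs A I"
      using that by (auto simp: pairs_def)
    moreover have "(A p ** A q) ** (A q ** A r) = - ((A q ** A r) ** (A p ** A q))"
    proof (rule anticommute_commute_mult)
      show "(A p ** A q) ** A q = - (A q ** (A p ** A q))"
        using clifford_anticommute_pair(2)[OF m(1,2) that(4)] by simp
      show "(A p ** A q) ** A r = A r ** (A p ** A q)"
        using that m by (intro clifford_commute_pair[symmetric]) auto
    qed
    ultimately show ?thesis by (simp add: good_def)
  qed
  \<comment> \<open>Split by the coincidences between \<open>k\<close>, \<open>l\<close> and
    \<open>i\<close>, \<open>j\<close>. Swapping factors, which \<open>good\<close> does not notice,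
    brings each single overlap into the form of \<open>chain\<close>.\<close>
  have "good (A k ** A l) (A i ** A j)"
  proof (cases "k = j")
    case True
    show ?thesis
    proof (cases "l = i")
      case l: True
      then have "good (A i ** A j) (A i ** A j)" by (simp add: good_def)
      then show ?thesis using swap[OF ij] good_uminus(1) True l by metis
    next
      case False
      then show ?thesis using chain[of i j l] True kl ij by auto
    qed
  next
    case kj: False
    show ?thesis
    proof (cases "l = j")
      case True
      show ?thesis
      proof (cases "k = i")
        case True
        with \<open>l = j\<close> show ?thesis by (simp add: good_def)
      next
        case False
        then have "good (A j ** A k) (A i ** A j)" using chain[of i j k] True kl ij by auto
        then show ?thesis using swap[of k j] True kl ij good_uminus(1) by metis
      qed
    next
      case lj: False
      show ?thesis
      proof (cases "k = i")
        case True
        then have "good (A i ** A l) (A j ** A i)" using chain[of j i l] lj kl ij by auto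
        then show ?thesis using swap[of j i] True ij good_uminus(2) by metis
      next
        case ki: False
        show ?thesis
        proof (cases "l = i")
          case True
          then have "good (A i ** A k) (A j ** A i)" using chain[of j i k] kj kl ij by auto
          then show ?thesis using swap[of j i] swap[of i k] True ki kl ij good_uminus by metis
        next
          case False
          then have "(A k ** A l) ** (A i ** A j) = (A i ** A j) ** (A k ** A l)"
            using kj lj ki kl ij I
            by (intro commute_mult) (auto intro!: clifford_commute_pair[symmetric])
          then show ?thesis by (simp add: good_def)
        qed
      qed
    qed
  qed
  then show "E ** (A i ** A j) = (A i ** A j) ** E \<or>
      (E ** (A i ** A j) = - ((A i ** A j) ** E) \<and> (A i ** A j) ** E \<in> pairs A I)"
    by (simp add: good_def kl(4))
qed

text \<open>Beyond products of pairs, two cases can anticommute: distinct singles, whose product is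
  a pair, and a single with a pair containing its index, whose product is plus or minus the other
  single.\<close>

lemma adapted_pairs_singles:
  assumes I: "I \<subseteq> {1..7}" and B: "B \<in> pairs A I \<or> B \<in> A ` I"
  shows "adapted (pairs A I \<union> singles A I) B"
proof -
  define T where "T = pairs A I \<union> singles A I"
  define good where "good = (\<lambda>E B. E ** B = B ** E \<or> (E ** B = - (B ** E) \<and> B ** E \<in> T))"
  have neg: "- M \<in> T \<longleftrightarrow> M \<in> T" for M
    using pairs_uminus[OF I, of M] pairs_uminus[OF I, of "- M"]
      singles_uminus[of M] singles_uminus[of "- M"] by (auto simp: T_def)
  have good_uminus: "good (- E) B = good E B" "good E (- B) = good E B" for E B
    by (simp_all add: good_def matrix_mult_minus_left matrix_mult_minus_right neg neg_eq_iff_eq_neg)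
  have AT: "A p \<in> T" if "p \<in> I" for p using that by (auto simp: T_def singles_def)
  have swap: "A p ** A q = - (A q ** A p)" if "p \<in> I" "q \<in> I" "p \<noteq> q" for p q
    using that I by (intro clifford_anticommute) auto
  have ss: "good (A p) (A q)" if "p \<in> I" "q \<in> I" for p q
    using that swap[OF that] by (cases "p = q") (auto simp: good_def T_def pairs_def)
  have sp: "good (A p) (A q ** A r) \<and> good (A q ** A r) (A p)"
    if "p \<in> I" "q \<in> I" "r \<in> I" "q \<noteq> r" for p q r
  proof -
    have m: "p \<in> {1..7}" "q \<in> {1..7}" "r \<in> {1..7}" using that I by auto
    have *: "A s ** (A s ** A t) = - A t" "(A s ** A t) ** A s = A t" if "s \<in> {1..7}" "t \<in> {1..7}" "s \<noteq> t" for s t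
      using clifford_anticommute_pair(1)[OF that] clifford_square_left[OF that(1)] by auto
    have **: "good (A s) (A s ** A t) \<and> good (A s ** A t) (A s)" if "s \<in> I" "t \<in> I" "s \<noteq> t" for s t
      using *[OF subsetD[OF I that(1)] subsetD[OF I that(2)] that(3)] AT[OF that(2)]
      by (auto simp: good_def neg)
    show ?thesis
    proof (cases "p = q \<or> p = r")
      case True
      then show ?thesis using **[of p q] **[of p r] swap[of q r] that good_uminus by metis
    next
      case False
      then show ?thesis using clifford_commute_pair[OF m(2,3,1)] by (auto simp: good_def)
    qed
  qed
  have pp: "good E B" if "E \<in> pairs A I" "B \<in> pairs A I" for E B
    using that adapted_pairs[OF I] unfolding adapted_def good_def T_def pairs_def by blast
  have "good E B" if E: "E \<in> pairs A I \<or> E \<in> A ` I" for E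
  proof -
    have "good E B" if "E \<in> pairs A I" "B \<in> A ` I"
      using that sp by (auto simp: pairs_def)
    moreover have "good E B" if "E \<in> A ` I" "B \<in> pairs A I"
      using that sp by (auto simp: pairs_def)
    moreover have "good E B" if "E \<in> A ` I" "B \<in> A ` I"
      using that ss by auto
    ultimately show ?thesis using E B pp by blast
  qed
  then have "good E B" if "E \<in> T" for E
    using that good_uminus by (auto simp: T_def singles_def)
  then show ?thesis by (simp add: adapted_def good_def T_def)
qed

end

section \<open>Traces of a symmetric form in the frame of \<open>x\<close> and in its images\<close>

section \<open>Orthonormal frames and the Laplacian\<close>

text \<open>Invariance of the trace: expand one argument of \<open>H b b\<close> in the orthonormal
  family, exchange the sums, and use symmetry to contract the standard basis back.\<close>

lemma sum_orthonormal_eq_sum_Basis: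
  fixes e :: "'i \<Rightarrow> 'a::euclidean_space"
  assumes I: "finite I" "card I = DIM('a)"
    and e: "\<And>i j. i \<in> I \<Longrightarrow> j \<in> I \<Longrightarrow> e i \<bullet> e j = (if i = j then 1 else 0)"
    and lin: "\<And>u. linear (H u)" and sym: "\<And>u v. H u v = (H v u :: real)"
  shows "(\<Sum>i\<in>I. H (e i) (e i)) = (\<Sum>b\<in>Basis. H b b)"
proof -
  have ne: "norm (e i) = 1" if "i \<in> I" for i
    using e[OF that that] by (simp add: norm_eq_1)
  have inj: "inj_on e I"
    by (rule inj_onI) (metis e zero_neq_one)
  have orth: "pairwise orthogonal (e ` I)"
    using e by (auto simp: pairwise_def orthogonal_def)
  have "independent (e ` I)"
    using ne by (intro pairwise_orthogonal_independent[OF orth]) force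
  moreover have "card (e ` I) = DIM('a)"
    using card_image[OF inj] I(2) by simp
  ultimately have "span (e ` I) = UNIV"
    using card_ge_dim_independent[of "e ` I" UNIV] by (auto simp: dim_UNIV)
  then have "(\<Sum>v\<in>e ` I. (b \<bullet> v) *\<^sub>R v) = b" for b
    using ne I(1) by (intro orthonormal_basis_expand[OF orth]) auto
  then have expand: "(\<Sum>i\<in>I. (b \<bullet> e i) *\<^sub>R e i) = b" for b
    by (simp add: sum.reindex[OF inj])
  have "(\<Sum>b\<in>Basis. H b b) = (\<Sum>b\<in>Basis. H b (\<Sum>i\<in>I. (b \<bullet> e i) *\<^sub>R e i))"
    by (simp add: expand)
  also have "\<dots> = (\<Sum>b\<in>Basis. \<Sum>i\<in>I. (b \<bullet> e i) * H b (e i))"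
    by (simp add: linear_sum[OF lin] linear_scale[OF lin])
  also have "\<dots> = (\<Sum>i\<in>I. \<Sum>b\<in>Basis. (e i \<bullet> b) * H (e i) b)"
    unfolding sum.swap[of _ I Basis] by (simp add: inner_commute sym)
  also have "\<dots> = (\<Sum>i\<in>I. H (e i) (\<Sum>b\<in>Basis. (e i \<bullet> b) *\<^sub>R b))"
    by (simp add: linear_sum[OF lin] linear_scale[OF lin])
  finally show ?thesis by (simp add: euclidean_representation)
qed

text \<open>The frame computation runs over all ordered index pairs, whereas the generating set
  takes each unordered pair once; hence the factor 2.\<close>

lemma sum_off_diagonal_symmetric:
  fixes s :: "nat \<Rightarrow> nat \<Rightarrow> real"
  assumes "finite I" and sym: "\<And>i j. i \<in> I \<Longrightarrow> j \<in> I \<Longrightarrow> i \<noteq> j \<Longrightarrow> s i j = s j i"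
  shows "(\<Sum>i\<in>I. \<Sum>j\<in>I - {i}. s i j) = 2 * (\<Sum>(i, j)\<in>{(i, j). i \<in> I \<and> j \<in> I \<and> i < j}. s i j)"
proof -
  define P where "P = {(i, j). i \<in> I \<and> j \<in> I \<and> i < j}"
  have fP: "finite P"
    using finite_subset[of P "I \<times> I"] assms(1) by (auto simp: P_def)
  have "(\<Sum>i\<in>I. \<Sum>j\<in>I - {i}. s i j) = (\<Sum>(i, j)\<in>Sigma I (\<lambda>i. I - {i}). s i j)"
    using assms(1) by (intro sum.Sigma) auto
  also have "Sigma I (\<lambda>i. I - {i}) = P \<union> prod.swap ` P"
    by (auto simp: P_def image_iff)
  also have "(\<Sum>(i, j)\<in>P \<union> prod.swap ` P. s i j) =
      (\<Sum>(i, j)\<in>P. s i j) + (\<Sum>(i, j)\<in>prod.swap ` P. s i j)"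
    using fP by (intro sum.union_disjoint) (auto simp: P_def)
  also have "(\<Sum>(i, j)\<in>prod.swap ` P. s i j) = (\<Sum>(i, j)\<in>P. s j i)"
    by (subst sum.reindex) (auto simp: case_prod_unfold)
  also have "\<dots> = (\<Sum>(i, j)\<in>P. s i j)"
    using sym by (intro sum.cong) (auto simp: P_def)
  finally show ?thesis by (simp add: P_def)
qed

text \<open>Polarization of \<open>skew_tangent\<close>, expanded at \<open>x + y\<close>.\<close>

lemma skew_inner:
  fixes M :: "real^'n^'n"
  assumes "skew M"
  shows "(M *v x) \<bullet> y = - (x \<bullet> (M *v y))"
  using skew_tangent[OF assms, of "x + y"] skew_tangent[OF assms, of x] skew_tangent[OF assms, of y]
  by (simp add: matrix_vector_right_distrib inner_add inner_commute)

context
  fixes A :: "nat \<Rightarrow> real^8^8"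
  assumes cliff: "clifford_family A"
begin

lemma clifford_square_vector: "i \<in> {1..7} \<Longrightarrow> A i *v (A i *v x) = - x"
  by (simp add: matrix_vector_mul_assoc clifford_square[OF cliff] matrix_vector_mult_minus_left)

lemma clifford_inner:
  assumes "k \<in> {1..7}"
  shows "(A k *v u) \<bullet> (A k *v v) = u \<bullet> v"
  using skew_inner[OF clifford_skew[OF cliff assms], of u "A k *v v"]
  by (simp add: clifford_square_vector[OF assms])

text \<open>Index 0 adds the normal vector \<open>x\<close> to the seven tangent vectors, giving
  eight vectors for the ambient space.\<close>

definition frame :: "real^8 \<Rightarrow> nat \<Rightarrow> real^8" where
  "frame x i = (if i = 0 then x else A i *v x)"

text \<open>The inner product of A_k x and A_l x is minus that of x and A_k A_l x, which vanishes
  because A_k A_l is skew for distinct indices. Lengths are preserved because each A_k is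
  orthogonal.\<close>

lemma frame_orthonormal:
  assumes x: "x \<in> sphere 0 1" and "i \<in> {0..7}" "j \<in> {0..7}"
  shows "frame x i \<bullet> frame x j = (if i = j then 1 else 0)"
proof -
  have xx: "x \<bullet> x = 1" using x by (simp add: norm_eq_1)
  have 0: "x \<bullet> (A k *v x) = 0" if "k \<in> {1..7}" for k
    by (intro skew_tangent clifford_skew[OF cliff] that)
  have 1: "(A k *v x) \<bullet> (A l *v x) = 0" if "k \<in> {1..7}" "l \<in> {1..7}" "k \<noteq> l" for k l
    using skew_inner[OF clifford_skew[OF cliff that(1)], of x "A l *v x"]
      skew_tangent[OF clifford_skew_pair[OF cliff that], of x]
    by (simp add: matrix_vector_mul_assoc)
  have 2: "(A k *v x) \<bullet> (A k *v x) = 1" if "k \<in> {1..7}" for k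
    using clifford_inner[OF that, of x x] xx by simp
  show ?thesis
    using assms(2,3) xx 0[of i] 0[of j] 1[of i j] 2[of i]
    by (auto simp: frame_def inner_commute)
qed

lemma sum_frame:
  assumes x: "x \<in> sphere 0 1" and lin: "\<And>u. linear (H u)" and sym: "\<And>u v. H u v = (H v u :: real)"
  shows "(\<Sum>i=1..7. H (A i *v x) (A i *v x)) = (\<Sum>b\<in>Basis. H b b) - H x x"
proof -
  have "(\<Sum>i\<in>{0..7}. H (frame x i) (frame x i)) = (\<Sum>b\<in>Basis. H b b)"
    by (rule sum_orthonormal_eq_sum_Basis[OF _ _ frame_orthonormal[OF x] lin sym]) auto
  moreover have "(\<Sum>i\<in>{0..7}. H (frame x i) (frame x i)) = H x x + (\<Sum>i=1..7. H (A i *v x) (A i *v x))"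
    by (simp add: frame_def sum.atLeast_Suc_atMost)
  ultimately show ?thesis by simp
qed

text \<open>The orthogonal \<open>A k\<close> carries the frame to another orthonormal basis. Index
  0 yields \<open>A k *v x\<close>, index \<open>k\<close> yields \<open>- x\<close>, and the other
  six vectors are the ones summed here.\<close>

lemma sum_frame_image:
  assumes x: "x \<in> sphere 0 1" and k: "k \<in> {1..7}"
    and lin: "\<And>u. linear (H u)" and sym: "\<And>u v. H u v = (H v u :: real)"
  shows "(\<Sum>j\<in>{1..7} - {k}. H ((A k ** A j) *v x) ((A k ** A j) *v x)) =
    (\<Sum>b\<in>Basis. H b b) - H (A k *v x) (A k *v x) - H x x"
proof -
  define h where "h = (\<lambda>j. H (A k *v (A j *v x)) (A k *v (A j *v x)))"
  have "(\<Sum>i\<in>{0..7}. H (A k *v frame x i) (A k *v frame x i)) = (\<Sum>b\<in>Basis. H b b)"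
    by (rule sum_orthonormal_eq_sum_Basis[OF _ _ _ lin sym])
      (auto simp: clifford_inner[OF k] frame_orthonormal[OF x])
  moreover have "(\<Sum>i\<in>{0..7}. H (A k *v frame x i) (A k *v frame x i)) =
      H (A k *v x) (A k *v x) + (\<Sum>j=1..7. h j)"
    by (simp add: frame_def h_def sum.atLeast_Suc_atMost)
  moreover have "(\<Sum>j=1..7. h j) = h k + (\<Sum>j\<in>{1..7} - {k}. h j)"
    using k by (intro sum.remove) auto
  moreover have "h k = H x x"
    using linear_neg[OF lin, of x x] linear_neg[OF lin, of "- x" x] sym[of "- x" x]
    by (simp add: h_def clifford_square_vector[OF k])
  ultimately show ?thesis
    by (simp add: h_def matrix_vector_mul_assoc)
qed

text \<open>Let S be the sum of H(A_i x, A_i x), that is, the trace minus H(x, x). Row i contributes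
  S - H(A_i x, A_i x), so the seven rows give 7S - S = 6S. The constant \<open>c\<close> is
  subtracted 42 times on both sides.\<close>

lemma sum_off_diagonal_frame:
  assumes x: "x \<in> sphere 0 1" and lin: "\<And>u. linear (H u)" and sym: "\<And>u v. H u v = (H v u :: real)"
  shows "(\<Sum>i=1..7. \<Sum>j\<in>{1..7} - {i}. H ((A i ** A j) *v x) ((A i ** A j) *v x) - c) =
    6 * (\<Sum>i=1..7. H (A i *v x) (A i *v x) - c)"
proof -
  have "(\<Sum>j\<in>{1..7} - {i}. H ((A i ** A j) *v x) ((A i ** A j) *v x) - c) =
      (\<Sum>b\<in>Basis. H b b) - H x x - 6 * c - H (A i *v x) (A i *v x)"
    if "i \<in> {1..7}" for i
    using sum_frame_image[OF x that lin sym] that by (simp add: sum_subtractf)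
  then have "(\<Sum>i=1..7. \<Sum>j\<in>{1..7} - {i}. H ((A i ** A j) *v x) ((A i ** A j) *v x) - c) =
      (\<Sum>i=1..7. (\<Sum>b\<in>Basis. H b b) - H x x - 6 * c - H (A i *v x) (A i *v x))"
    by (intro sum.cong) auto
  then show ?thesis
    using sum_frame[OF x lin sym] by (simp add: sum_subtractf)
qed

end

section \<open>Structure of the generating sets: inclusions and adaptedness\<close>

section \<open>Generating sets\<close>

definition ordered_pairs :: "(nat \<Rightarrow> real^8^8) \<Rightarrow> nat set \<Rightarrow> (real^8^8) set" where
  "ordered_pairs A I = (\<lambda>(i, j). A i ** A j) ` {(i, j). i \<in> I \<and> j \<in> I \<and> i < j}"

lemma gen_set_low: "1 \<le> l \<Longrightarrow> l \<le> 4 \<Longrightarrow> gen_set A l = ordered_pairs A {1..l + 1}"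
  unfolding gen_set_def ordered_pairs_def by (auto simp: image_iff)

lemma gen_set_5: "gen_set A 5 = ordered_pairs A {1..5} \<union> ordered_pairs A {6, 7}"
  unfolding gen_set_def ordered_pairs_def by (auto simp: image_iff)

lemma gen_set_6: "gen_set A 6 = gen_set A 5 \<union> A ` {6, 7}"
  by (simp add: gen_set_def)

lemma gen_set_7: "gen_set A 7 = ordered_pairs A {1..7} \<union> A ` {1..7}"
  unfolding gen_set_def ordered_pairs_def by (auto simp: image_iff)

lemma ordered_pairs_mono: "I \<subseteq> J \<Longrightarrow> ordered_pairs A I \<subseteq> ordered_pairs A J"
  by (auto simp: ordered_pairs_def)

lemma gen_set_mono:
  assumes "1 \<le> l" "l \<le> m" "m \<le> 7"
  shows "gen_set A l \<subseteq> gen_set A m"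
proof -
  have 67: "gen_set A 6 \<subseteq> gen_set A 7"
    using ordered_pairs_mono[of "{1..5}" "{1..7}" A] ordered_pairs_mono[of "{6, 7}" "{1..7}" A]
    by (auto simp: gen_set_5 gen_set_6 gen_set_7)
  have 56: "gen_set A 5 \<subseteq> gen_set A 6"
    by (auto simp: gen_set_6)
  have 45: "gen_set A 4 \<subseteq> gen_set A 5"
    by (auto simp: gen_set_5 gen_set_low)
  have low: "gen_set A l \<subseteq> gen_set A m" if "1 \<le> l" "l \<le> m" "m \<le> 4" for l m
    using that by (simp add: gen_set_low ordered_pairs_mono)
  have top: "gen_set A l \<subseteq> gen_set A m" if "4 \<le> l" "l \<le> m" "m \<le> 7" for l m
  proof -
    have "l \<in> {4, 5, 6, 7}" "m \<in> {4, 5, 6, 7}" using that by auto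
    then show ?thesis using that 45 56 67 by auto
  qed
  show ?thesis
    using low[of l m] low[of l 4] top[of 4 m] top[of l m] assms by (meson linear order_refl subset_trans)
qed

context
  fixes A :: "nat \<Rightarrow> real^8^8"
  assumes cliff: "clifford_family A"
begin

lemma ordered_pairs_signed:
  assumes I: "I \<subseteq> {1..7}"
  shows "ordered_pairs A I \<union> uminus ` ordered_pairs A I = pairs A I"
proof
  have "ordered_pairs A I \<subseteq> pairs A I"
    by (auto simp: ordered_pairs_def pairs_def)
  then show "ordered_pairs A I \<union> uminus ` ordered_pairs A I \<subseteq> pairs A I"
    using pairs_uminus[OF cliff I] by auto
  show "pairs A I \<subseteq> ordered_pairs A I \<union> uminus ` ordered_pairs A I"
  proof
    fix E assume "E \<in> pairs A I"
    then obtain i j where ij: "i \<in> I" "j \<in> I" "i \<noteq> j" "E = A i ** A j"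
      by (auto simp: pairs_def)
    have op: "A p ** A q \<in> ordered_pairs A I" if "p \<in> I" "q \<in> I" "p < q" for p q
      using that by (auto simp: ordered_pairs_def)
    show "E \<in> ordered_pairs A I \<union> uminus ` ordered_pairs A I"
    proof (cases "i < j")
      case True
      then show ?thesis using op ij by simp
    next
      case False
      then have "A j ** A i \<in> ordered_pairs A I" using op ij by simp
      moreover have "E = - (A j ** A i)"
        using ij by (auto intro!: clifford_anticommute[OF cliff] subsetD[OF I])
      ultimately show ?thesis by blast
    qed
  qed
qed

lemma ordered_pairs_subset: "I \<subseteq> {1..7} \<Longrightarrow> ordered_pairs A I \<subseteq> pairs A I"
  using ordered_pairs_signed by blast

text \<open>Up to level 4 and at level 7 the signed set is a single block, over
  \<open>{1..l + 1}\<close> or over all indices. At levels 5 and 6 it splits into blocks over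
  \<open>{1..5}\<close> and \<open>{6, 7}\<close>: each block is adapted to its own members, and the
  two commute because the first contains only pair products.\<close>

lemma adapted_gen_set:
  assumes l: "l \<in> {1..7}" and B: "B \<in> gen_set A l"
  shows "adapted (gen_set A l \<union> uminus ` gen_set A l) B"
proof -
  have I: "{1..5} \<subseteq> {1..7::nat}" "{6, 7} \<subseteq> {1..7::nat}" "{1..5} \<inter> {6, 7::nat} = {}" "{6, 7} \<inter> {1..5::nat} = {}"
    by auto
  have own: "adapted (pairs A J) C" if "J \<subseteq> {1..7}" "C \<in> pairs A J" for C J
    using that adapted_pairs[OF cliff that(1)] by (auto simp: pairs_def)
  have cross: "adapted T C"
    if "J \<subseteq> {1..7}" "K \<subseteq> {1..7}" "J \<inter> K = {}" "C \<in> pairs A J" "T \<subseteq> pairs A K \<union> singles A K" for J K C T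
    using that(5) by (intro adapted_commute pairs_commute_disjoint[OF cliff that(1-4)]) blast
  have s5: "gen_set A 5 \<union> uminus ` gen_set A 5 = pairs A {1..5} \<union> pairs A {6, 7}"
    using ordered_pairs_signed[OF I(1)] ordered_pairs_signed[OF I(2)] by (auto simp: gen_set_5)
  consider "l \<le> 4" | "l = 5" | "l = 6" | "l = 7" using l by fastforce
  then show ?thesis
  proof cases
    case 1
    then have I: "{1..l + 1} \<subseteq> {1..7}" by auto
    show ?thesis
      using own[OF I] ordered_pairs_subset[OF I] B l 1 ordered_pairs_signed[OF I]
      by (auto simp: gen_set_low)
  next
    case 2
    have "B \<in> pairs A {1..5} \<or> B \<in> pairs A {6, 7}"
      using B s5 2 by blast
    then show ?thesis
      unfolding 2 s5
    proof
      assume B: "B \<in> pairs A {1..5}"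
      show "adapted (pairs A {1..5} \<union> pairs A {6, 7}) B"
        by (rule adapted_Un[OF own[OF I(1) B] cross[OF I(1,2,3) B]]) simp
    next
      assume B: "B \<in> pairs A {6, 7}"
      show "adapted (pairs A {1..5} \<union> pairs A {6, 7}) B"
        by (rule adapted_Un[OF cross[OF I(2,1,4) B] own[OF I(2) B]]) simp
    qed
  next
    case 3
    have s6: "gen_set A 6 \<union> uminus ` gen_set A 6 = pairs A {1..5} \<union> (pairs A {6, 7} \<union> singles A {6, 7})"
      using s5 by (auto simp: gen_set_6 singles_def)
    have "B \<in> pairs A {1..5} \<or> B \<in> pairs A {6, 7} \<or> B \<in> A ` {6, 7}"
      using B s5 3 gen_set_6 by blast
    then show ?thesis
    proof (elim disjE)
      assume B: "B \<in> pairs A {1..5}"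
      show ?thesis unfolding 3 s6
        by (rule adapted_Un[OF own[OF I(1) B] cross[OF I(1,2,3) B]]) simp
    next
      assume B: "B \<in> pairs A {6, 7}"
      show ?thesis unfolding 3 s6
        by (rule adapted_Un[OF cross[OF I(2,1,4) B] adapted_pairs_singles[OF cliff I(2) disjI1[OF B]]])
          simp
    next
      assume B: "B \<in> A ` {6, 7}"
      then obtain k where k: "B = A k" "k \<in> {1..7}" "k \<notin> {1..5}" by auto
      have "adapted (pairs A {1..5}) B"
        unfolding k(1) by (intro adapted_commute single_commute_pairs_disjoint[OF cliff I(1) k(2,3)])
      then show ?thesis unfolding 3 s6
        by (rule adapted_Un[OF _ adapted_pairs_singles[OF cliff I(2) disjI2[OF B]]])
    qed
  next
    case 4
    have "gen_set A 7 \<union> uminus ` gen_set A 7 = pairs A {1..7} \<union> singles A {1..7}"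
      using ordered_pairs_signed[of "{1..7}"] by (auto simp: gen_set_7 singles_def)
    moreover have "B \<in> pairs A {1..7} \<or> B \<in> A ` {1..7}"
      using B 4 ordered_pairs_subset[of "{1..7}"] by (auto simp: gen_set_7)
    ultimately show ?thesis
      using adapted_pairs_singles[OF cliff subset_refl] 4 by simp
  qed
qed

text \<open>Level 7 is excluded because \<open>A 1\<close> anticommutes with \<open>A 6\<close> and
  their product leaves the set. Up to level 6 every generator either has its indices in
  \<open>{1..5}\<close> as a pair, and commutes, or belongs to the block over
  \<open>{6, 7}\<close>.\<close>

lemma adapted_gen_set_vertical:
  assumes l: "l \<in> {1..6}" and B: "B \<in> gen_set A l"
  shows "adapted (pairs A {6, 7} \<union> singles A {6, 7}) B"
proof -
  have I: "{1..5} \<subseteq> {1..7::nat}" "{6, 7} \<subseteq> {1..7::nat}" "{1..5} \<inter> {6, 7::nat} = {}"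
    by auto
  have "B \<in> gen_set A 6" using B gen_set_mono[of l 6 A] l by auto
  then consider "B \<in> pairs A {1..5}" | "B \<in> pairs A {6, 7} \<or> B \<in> A ` {6, 7}"
    using ordered_pairs_subset[OF I(1)] ordered_pairs_subset[OF I(2)]
    by (auto simp: gen_set_6 gen_set_5)
  then show ?thesis
  proof cases
    case 1
    then show ?thesis by (intro adapted_commute pairs_commute_disjoint[OF cliff I])
  next
    case 2
    then show ?thesis by (rule adapted_pairs_singles[OF cliff I(2)])
  qed
qed

section \<open>Distinctness of the generators and the Laplacian as a quarter of the full sum\<close>

lemma gen_set_7_cases:
  assumes "E \<in> gen_set A 7"
  obtains i j where "i \<in> {1..7}" "j \<in> {1..7}" "i < j" "E = A i ** A j"
    | k where "k \<in> {1..7}" "E = A k"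
  using assms by (auto simp: gen_set_7 ordered_pairs_def)

lemma gen_set_7_skew: "E \<in> gen_set A 7 \<Longrightarrow> skew E"
  by (erule gen_set_7_cases) (simp_all add: clifford_skew[OF cliff] clifford_skew_pair[OF cliff])

lemma gen_set_7_square: "E \<in> gen_set A 7 \<Longrightarrow> E ** E = - mat 1"
  by (erule gen_set_7_cases) (simp_all add: clifford_square[OF cliff] clifford_square_pair[OF cliff])

lemma gen_set_subset_7: "l \<in> {1..7} \<Longrightarrow> gen_set A l \<subseteq> gen_set A 7"
  using gen_set_mono[of l 7 A] by simp

lemma finite_gen_set:
  assumes "l \<in> {1..7}"
  shows "finite (gen_set A l)"
proof -
  have "finite (ordered_pairs A {1..7})"
    unfolding ordered_pairs_def
    by (rule finite_imageI, rule finite_subset[of _ "{1..7} \<times> {1..7}"]) auto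
  then have "finite (gen_set A 7)" by (simp add: gen_set_7)
  then show ?thesis using gen_set_subset_7[OF assms] finite_subset by blast
qed

text \<open>Equal on \<open>E\<close> and \<open>- E\<close> but different on any two generators: this shows that the generators
  are pairwise distinct, even up to sign.\<close>

definition commutant :: "real^8^8 \<Rightarrow> nat set" where
  "commutant E = {m \<in> {1..7}. A m ** E = E ** A m}"

lemma anticommute_not_commute:
  assumes "m \<in> {1..7}" "E ** E = - mat 1" "A m ** E = - (E ** A m)"
  shows "A m ** E \<noteq> E ** A m"
proof
  assume "A m ** E = E ** A m"
  then have "A m ** E = - (A m ** E)" using assms(3) by simp
  then have "A m ** E = 0" by (simp add: vec_eq_iff)
  then have "E = 0" using clifford_square_left[OF cliff assms(1), of E] by simp
  then have "(mat 1 :: real^8^8) = 0" using assms(2) by simp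
  then have "(mat 1 :: real^8^8) $ 1 $ 1 = 0" by simp
  then show False by (simp add: mat_def)
qed

lemma commutant_single:
  assumes "k \<in> {1..7}"
  shows "commutant (A k) = {k}"
proof -
  have "A m ** A k \<noteq> A k ** A m" if "m \<in> {1..7}" "m \<noteq> k" for m
    using that assms by (intro anticommute_not_commute clifford_square[OF cliff] clifford_anticommute[OF cliff])
  then show ?thesis using assms by (auto simp: commutant_def)
qed

lemma commutant_pair:
  assumes "i \<in> {1..7}" "j \<in> {1..7}" "i < j"
  shows "commutant (A i ** A j) = {1..7} - {i, j}"
proof -
  have ne: "i \<noteq> j" using assms(3) by simp
  note sq = clifford_square_pair[OF cliff assms(1,2) ne]
  have "i \<notin> commutant (A i ** A j)" "j \<notin> commutant (A i ** A j)"
    using anticommute_not_commute[OF assms(1) sq clifford_anticommute_pair(1)[OF cliff assms(1,2) ne]]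
      anticommute_not_commute[OF assms(2) sq clifford_anticommute_pair(2)[OF cliff assms(1,2) ne]]
    by (simp_all add: commutant_def)
  moreover have "m \<in> commutant (A i ** A j)" if "m \<in> {1..7} - {i, j}" for m
    using that assms clifford_commute_pair[OF cliff assms(1,2), of m] by (auto simp: commutant_def)
  ultimately show ?thesis by (auto simp: commutant_def)
qed

lemma commutant_pair_neq_single:
  assumes "i \<in> {1..7}" "j \<in> {1..7}" "i < j" "k \<in> {1..7}"
  shows "commutant (A i ** A j) \<noteq> commutant (A k)"
proof
  assume "commutant (A i ** A j) = commutant (A k)"
  then have "{1..7} - {i, j} = {k}" by (simp only: commutant_pair[OF assms(1-3)] commutant_single[OF assms(4)])
  \<comment> \<open>Counting: equal commutants would cover seven indices by three.\<close>
  then have "{1..7} \<subseteq> set [i, j, k]" by auto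
  then have "card {1..7::nat} \<le> card (set [i, j, k])" by (intro card_mono) auto
  then show False using card_length[of "[i, j, k]"] by simp
qed

lemma commutant_pair_inject:
  assumes "i \<in> {1..7}" "j \<in> {1..7}" "i < j" "k \<in> {1..7}" "l \<in> {1..7}" "k < l"
    and "commutant (A i ** A j) = commutant (A k ** A l)"
  shows "i = k \<and> j = l"
proof -
  have "{1..7} - {i, j} = {1..7} - {k, l}"
    using assms(7) by (simp only: commutant_pair[OF assms(1-3)] commutant_pair[OF assms(4-6)])
  then have "{i, j} = {k, l}" using assms(1-6) by blast
  then show ?thesis using assms(3,6) by (auto simp: doubleton_eq_iff)
qed

lemma commutant_inject:
  assumes "E \<in> gen_set A 7" "E' \<in> gen_set A 7" "commutant E = commutant E'"
  shows "E = E'"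
  using assms(1)
proof (cases rule: gen_set_7_cases)
  case (1 i j)
  show ?thesis using assms(2)
    by (cases rule: gen_set_7_cases)
      (use 1 assms(3) commutant_pair_inject commutant_pair_neq_single in blast)+
next
  case (2 k)
  show ?thesis using assms(2)
  proof (cases rule: gen_set_7_cases)
    case (1 i j)
    then show ?thesis using 2 assms(3) commutant_pair_neq_single by metis
  next
    case (2 m)
    then show ?thesis using \<open>E = A k\<close> \<open>k \<in> {1..7}\<close> assms(3) by (simp add: commutant_single)
  qed
qed

text \<open>The commutant does not see signs, so two opposite generators would coincide. This gives
  E = 0, against E^2 = -1.\<close>

lemma gen_set_7_uminus:
  assumes "E \<in> gen_set A 7"
  shows "- E \<notin> gen_set A 7"
proof
  assume "- E \<in> gen_set A 7"
  moreover have "commutant (- E) = commutant E"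
    by (simp add: commutant_def matrix_mult_minus_left matrix_mult_minus_right)
  ultimately have "- E = E" using commutant_inject assms by blast
  then have "E = 0" by (auto simp: vec_eq_iff)
  then have "(mat 1 :: real^8^8) $ 1 $ 1 = 0" using gen_set_7_square[OF assms] by simp
  then show False by (simp add: mat_def)
qed

text \<open>A sum over a set counts coinciding matrices once. Separation by commutants shows that no
  two index expressions coincide, so the sum can be taken over indices.\<close>

lemma sum_gen_set_7:
  fixes g :: "real^8^8 \<Rightarrow> real"
  shows "(\<Sum>E\<in>gen_set A 7. g E) =
    (\<Sum>(i, j)\<in>{(i, j). i \<in> {1..7} \<and> j \<in> {1..7} \<and> i < j}. g (A i ** A j)) + (\<Sum>k=1..7. g (A k))"
proof -
  have "ordered_pairs A {1..7} \<inter> A ` {1..7} = {}"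
    using commutant_pair_neq_single by (fastforce simp: ordered_pairs_def)
  then have "(\<Sum>E\<in>gen_set A 7. g E) = (\<Sum>E\<in>ordered_pairs A {1..7}. g E) + (\<Sum>E\<in>A ` {1..7}. g E)"
    using finite_gen_set[of 7] unfolding gen_set_7 by (intro sum.union_disjoint) auto
  also have "(\<Sum>E\<in>A ` {1..7}. g E) = (\<Sum>k=1..7. g (A k))"
  proof -
    have "inj_on A {1..7}"
      by (rule inj_onI) (metis commutant_single singleton_inject)
    then show ?thesis by (simp add: sum.reindex)
  qed
  also have "(\<Sum>E\<in>ordered_pairs A {1..7}. g E) =
      (\<Sum>(i, j)\<in>{(i, j). i \<in> {1..7} \<and> j \<in> {1..7} \<and> i < j}. g (A i ** A j))"
  proof -
    have "inj_on (\<lambda>(i, j). A i ** A j) {(i, j). i \<in> {1..7} \<and> j \<in> {1..7} \<and> i < j}"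
    proof (rule inj_onI)
      fix p q :: "nat \<times> nat"
      assume pq: "p \<in> {(i, j). i \<in> {1..7} \<and> j \<in> {1..7} \<and> i < j}"
        "q \<in> {(i, j). i \<in> {1..7} \<and> j \<in> {1..7} \<and> i < j}"
        "(case p of (i, j) \<Rightarrow> A i ** A j) = (case q of (i, j) \<Rightarrow> A i ** A j)"
      obtain i j k l where "p = (i, j)" "q = (k, l)" by (metis surj_pair)
      then show "p = q" using pq commutant_pair_inject[of i j k l] by simp
    qed
    then show ?thesis
      unfolding ordered_pairs_def by (simp add: sum.reindex case_prod_unfold)
  qed
  finally show ?thesis .
qed

text \<open>As E^2 = -1, each X(E)^2 f has the value H(Ex, Ex) - L(x) at \<open>x\<close>. The
  ordered pairs of distinct indices give 6 times the sum over the singles, hence the pairs with i <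
  j give 3 times it; the singles themselves make 4.\<close>

lemma sumsq_gen_set_7:
  assumes f: "smooth_on_sphere f" and x: "x \<in> sphere 0 1"
  shows "sumsq (gen_set A 7) f x = 4 * (\<Sum>k=1..7. sphere_vf (A k) (sphere_vf (A k) f) x)"
proof -
  obtain H L where lin: "linear L" "\<And>u. linear (H u)" and sym: "\<And>u v. H u v = (H v u :: real)"
    and HL: "\<And>E G. skew E \<Longrightarrow> skew G \<Longrightarrow>
      sphere_vf E (sphere_vf G f) x = H (E *v x) (G *v x) + L (G *v (E *v x))"
    using sphere_vf_jet[OF f x] by blast
  define q where "q = (\<lambda>E. H (E *v x) (E *v x) - L x)"
  have q: "sphere_vf E (sphere_vf E f) x = q E" if "E \<in> gen_set A 7" for E
  proof -
    have "E *v (E *v x) = - x"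
      using gen_set_7_square[OF that] by (simp add: matrix_vector_mul_assoc matrix_vector_mult_minus_left)
    then show ?thesis
      using HL[OF gen_set_7_skew[OF that] gen_set_7_skew[OF that]] linear_neg[OF lin(1)]
      by (simp add: q_def)
  qed
  have q_uminus: "q (- E) = q E" for E
    using linear_neg[OF lin(2)] sym by (simp add: q_def matrix_vector_mult_minus_left)
  have "q (A i ** A j) = q (A j ** A i)" if "i \<in> {1..7}" "j \<in> {1..7}" "i \<noteq> j" for i j
    using clifford_anticommute[OF cliff that] q_uminus by simp
  from sum_off_diagonal_symmetric[of "{1..7}" "\<lambda>i j. q (A i ** A j)", OF _ this]
  have "2 * (\<Sum>(i, j)\<in>{(i, j). i \<in> {1..7} \<and> j \<in> {1..7} \<and> i < j}. q (A i ** A j)) =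
      (\<Sum>i=1..7. \<Sum>j\<in>{1..7} - {i}. q (A i ** A j))"
    by simp
  also have "\<dots> = 6 * (\<Sum>k=1..7. q (A k))"
    unfolding q_def by (rule sum_off_diagonal_frame[OF cliff x lin(2) sym])
  finally have "(\<Sum>E\<in>gen_set A 7. q E) = 4 * (\<Sum>k=1..7. q (A k))"
    unfolding sum_gen_set_7 by simp
  then show ?thesis
    using q by (simp add: sumsq_def gen_set_7)
qed

section \<open>Commutation of the operators with one another and with the sublaplacian\<close>

lemma gen_op_sphere_vf:
  assumes l: "l \<in> {1..7}" and B: "B \<in> gen_set A l" and f: "smooth_on_sphere f" and x: "x \<in> sphere 0 1"
  shows "sumsq (gen_set A l) (sphere_vf B f) x = sphere_vf B (sumsq (gen_set A l) f) x"
proof (rule sumsq_sphere_vf_signed[OF finite_gen_set[OF l] _ _ _ _ adapted_gen_set[OF l B] f x])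
  have sub: "E \<in> gen_set A 7" if "E \<in> gen_set A l" for E
    using that gen_set_subset_7[OF l] by blast
  show "skew E" if "E \<in> gen_set A l" for E by (rule gen_set_7_skew[OF sub[OF that]])
  show "- E \<notin> gen_set A l" if "E \<in> gen_set A l" for E
    using gen_set_7_uminus[OF sub[OF that]] sub by blast
  show "skew B" by (rule gen_set_7_skew[OF sub[OF B]])
  show "B ** B = - mat 1" by (rule gen_set_7_square[OF sub[OF B]])
qed

text \<open>By monotonicity each field occurring at level \<open>l\<close> also occurs at level
  \<open>m\<close>, and the sum at level \<open>m\<close> commutes with all its own fields.\<close>

lemma gen_op_commute_le:
  assumes l: "l \<in> {1..7}" "m \<in> {1..7}" "l \<le> m" and f: "smooth_on_sphere f" and x: "x \<in> sphere 0 1"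
  shows "sumsq (gen_set A m) (sumsq (gen_set A l) f) x = sumsq (gen_set A l) (sumsq (gen_set A m) f) x"
proof (rule sumsq_commute[OF _ _ _ f x])
  show "skew E" if "E \<in> gen_set A l" for E using that gen_set_7_skew gen_set_subset_7[OF l(1)] by blast
  show "skew E" if "E \<in> gen_set A m" for E using that gen_set_7_skew gen_set_subset_7[OF l(2)] by blast
  have "gen_set A l \<subseteq> gen_set A m" using l by (intro gen_set_mono) auto
  then show "sumsq (gen_set A m) (sphere_vf B g) y = sphere_vf B (sumsq (gen_set A m) g) y"
    if "B \<in> gen_set A l" "smooth_on_sphere g" "y \<in> sphere 0 1" for B g y
    using that l(2) by (intro gen_op_sphere_vf) auto
qed

lemma gen_op_commute:
  assumes l: "l \<in> {1..7}" "m \<in> {1..7}" and f: "smooth_on_sphere f" and x: "x \<in> sphere 0 1"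
  shows "sumsq (gen_set A m) (sumsq (gen_set A l) f) x = sumsq (gen_set A l) (sumsq (gen_set A m) f) x"
  using gen_op_commute_le[OF l _ f x] gen_op_commute_le[OF l(2,1) _ f x] by (cases "l \<le> m") auto

text \<open>The three matrices satisfy the relations of the quaternion units. Their fields are
  tangent to the orbits of the unit quaternions, the fibres of a quaternionic Hopf
  fibration.\<close>

definition vertical :: "(real^8^8) set" where
  "vertical = {A 6, A 7, A 6 ** A 7}"

lemma vertical_subset: "vertical \<subseteq> gen_set A 6"
  by (auto simp: vertical_def gen_set_6 gen_set_5 ordered_pairs_def)

lemma vertical_subset_7: "vertical \<subseteq> gen_set A 7"
  using vertical_subset gen_set_mono[of 6 7 A] by auto

lemma vertical_skew: "E \<in> vertical \<Longrightarrow> skew E"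
  using vertical_subset_7 gen_set_7_skew by blast

text \<open>The roles change at level 6. From there on the vertical matrices are generators, and the
  sum over \<open>gen_set A l\<close> commutes with each vertical field. Below, the vertical sum
  commutes with each field of \<open>gen_set A l\<close>.\<close>

lemma vertical_commute:
  assumes l: "l \<in> {1..7}" and f: "smooth_on_sphere f" and x: "x \<in> sphere 0 1"
  shows "sumsq (gen_set A l) (sumsq vertical f) x = sumsq vertical (sumsq (gen_set A l) f) x"
proof (cases "l \<le> 5")
  case False
  have "gen_set A 6 \<subseteq> gen_set A l" using False l by (intro gen_set_mono) auto
  then have "vertical \<subseteq> gen_set A l" using vertical_subset by blast
  then show ?thesis
    using gen_set_7_skew gen_set_subset_7[OF l]
    by (intro sumsq_commute[OF _ _ _ f x]) (use gen_op_sphere_vf[OF l] in blast)+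
next
  case True
  have s: "vertical \<union> uminus ` vertical = pairs A {6, 7} \<union> singles A {6, 7}"
  proof -
    have "vertical = ordered_pairs A {6, 7} \<union> A ` {6, 7}"
      by (auto simp: vertical_def ordered_pairs_def)
    then show ?thesis
      using ordered_pairs_signed[of "{6, 7}"] by (auto simp: singles_def)
  qed
  have comm: "sumsq vertical (sphere_vf B g) y = sphere_vf B (sumsq vertical g) y"
    if "B \<in> gen_set A l" "smooth_on_sphere g" "y \<in> sphere 0 1" for B g y
  proof (rule sumsq_sphere_vf_signed[OF _ _ _ _ _ _ that(2,3)])
    have B: "B \<in> gen_set A 7" using that(1) gen_set_subset_7[OF l] by blast
    show "finite vertical" by (simp add: vertical_def)
    show "skew E" if "E \<in> vertical" for E using vertical_skew[OF that] .
    show "- E \<notin> vertical" if "E \<in> vertical" for E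
      using that vertical_subset_7 gen_set_7_uminus by blast
    show "skew B" using gen_set_7_skew[OF B] .
    show "B ** B = - mat 1" using gen_set_7_square[OF B] .
    show "adapted (vertical \<union> uminus ` vertical) B"
      unfolding s by (rule adapted_gen_set_vertical[OF _ that(1)]) (use l True in auto)
  qed
  have "skew E" if "E \<in> gen_set A l" for E
    using that gen_set_7_skew gen_set_subset_7[OF l] by blast
  then show ?thesis
    by (rule sumsq_commute[OF _ vertical_skew comm f x, symmetric])
qed

text \<open>The Laplacian is minus the sum of squares over the \<open>A k\<close>, hence -1/4 of the
  full sum. Distinctness of the three vertical matrices, again read off from commutants, makes the
  sum over the set \<open>vertical\<close> equal to the three explicit terms.\<close>

lemma sublaplacian_QH_eq:
  assumes f: "smooth_on_sphere f" and x: "x \<in> sphere 0 1"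
  shows "sublaplacian_QH A f x = (- 1 / 4) * sumsq (gen_set A 7) f x + sumsq vertical f x"
proof -
  have "A 6 \<noteq> A 7"
    using commutant_single[of 6] commutant_single[of 7] by auto
  moreover have "A 6 \<noteq> A 6 ** A 7" "A 7 \<noteq> A 6 ** A 7"
    using commutant_pair_neq_single[of 6 7 6] commutant_pair_neq_single[of 6 7 7] by auto
  ultimately have "sumsq vertical f x = sphere_vf (A 6) (sphere_vf (A 6) f) x
     + sphere_vf (A 7) (sphere_vf (A 7) f) x
     + sphere_vf (A 6 ** A 7) (sphere_vf (A 6 ** A 7) f) x"
    by (simp add: sumsq_def vertical_def)
  then show ?thesis
    using sumsq_gen_set_7[OF f x] by (simp add: sublaplacian_QH_def sphere_laplacian_def)
qed

lemma gen_op_sublaplacian_commute: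
  assumes l: "l \<in> {1..7}" and f: "smooth_on_sphere f" and x: "x \<in> sphere 0 1"
  shows "sumsq (gen_set A l) (sublaplacian_QH A f) x = sublaplacian_QH A (sumsq (gen_set A l) f) x"
proof -
  have sk: "skew E" if "E \<in> gen_set A l" for E
    using that gen_set_7_skew gen_set_subset_7[OF l] by blast
  let ?G = "sumsq (gen_set A l)" and ?C = "sumsq (gen_set A 7)" and ?V = "sumsq vertical"
  note sm = smooth_on_sphere_sumsq smooth_on_sphere_cmult smooth_on_sphere_add
  have smC: "smooth_on_sphere (\<lambda>y. (- 1 / 4) * ?C f y)"
    by (intro sm gen_set_7_skew f)
  have smV: "smooth_on_sphere (?V f)"
    by (intro sm vertical_skew f)
  \<comment> \<open>The formula for the sublaplacian holds on the sphere, so it passes under the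
    outer operator by congruence. The congruence is used backwards because smoothness is at hand for
    the explicit combination.\<close>
  have "?G (sublaplacian_QH A f) x = ?G (\<lambda>y. (- 1 / 4) * ?C f y + ?V f y) x"
    by (intro sumsq_cong[symmetric] sk sublaplacian_QH_eq[symmetric] smooth_on_sphere_add smC smV f x)
  also have "\<dots> = ?G (\<lambda>y. (- 1 / 4) * ?C f y) x + ?G (?V f) x"
    by (intro sumsq_add sk smC smV x)
  also have "?G (\<lambda>y. (- 1 / 4) * ?C f y) x = (- 1 / 4) * ?G (?C f) x"
    by (intro sumsq_cmult sm sk gen_set_7_skew f x)
  also have "(- 1 / 4) * ?G (?C f) x + ?G (?V f) x = (- 1 / 4) * ?C (?G f) x + ?V (?G f) x"
    using gen_op_commute[OF l _ f x, of 7] vertical_commute[OF l f x] by simp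
  also have "\<dots> = sublaplacian_QH A (?G f) x"
    by (intro sublaplacian_QH_eq[symmetric] sm sk f x)
  finally show ?thesis .
qed

end

theorem proposition6p2:
  fixes A :: "nat \<Rightarrow> real^8^8"
  assumes "clifford_family A"
  shows "(\<forall>l\<in>{1..7}. \<forall>m\<in>{1..7}. commute_on_sphere (gen_op A l) (gen_op A m)) \<and>
    (\<forall>l\<in>{1..7}. commute_on_sphere (gen_op A l) (sublaplacian_QH A))"
proof -
  have "gen_op A l = sumsq (gen_set A l)" for l
    by (simp add: gen_op_def sumsq_def fun_eq_iff)
  then show ?thesis
    using gen_op_commute[OF assms] gen_op_sublaplacian_commute[OF assms]
    by (simp add: commute_on_sphere_def)
qed

end
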